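(* Let $(K,v)$ be a henselian valued field with algebraic closure $\overline K$. Let $[\alpha_0,\dots,\alpha_r]$ be a complete Okutsu sequence for $\theta\in\overline K$, let $\delta_i=v(\theta-\alpha_i)$ for $0\le i\le r$, let $F$ be the minimal polynomial of $\theta$ over $K$, and let $\lambda_0,\dots,\lambda_r$ be the secondary slopes of the inductive valuation $\mu_F$ attached to $F$. If $\alpha_r$ is tame over $K$, then $$ \delta_i=\lambda_0+\cdots+\lambda_i,\qquad 0\le i\le r. $$
   Context: $(K,v)$ is a henselian valued field with residue field $k$; $v$ also denotes its unique extension to the fixed algebraic closure $\overline K$. $\mathbb{Q}\Gamma=v(K^* )\otimes\mathbb{Q}$ is the value group of $v$ on $\overline K$. $\deg_K(\alpha)=[K(\alpha):K]$. Complete Okutsu sequence: let $\alpha_0,\dots,\alpha_r,\theta=\alpha_{r+1}\in\overline K$ with $1=\deg_K(\alpha_0)<\cdots<\deg_K(\alpha_r)<\deg_K(\theta)$. The list $[\alpha_0,\dots,\alpha_r]$ is a complete Okutsu sequence for $\theta$ if for all $\beta\in\overline K$ and all $0\le i\le r$: (a) $\deg_K(\beta)<\deg_K(\alpha_{i+1})$ implies $v(\theta-\beta)\le v(\theta-\alpha_i)$; (b) $\deg_K(\beta)<\deg_K(\alpha_i)$ implies $v(\theta-\beta)<v(\theta-\alpha_i)$. Tame: $\alpha\in\overline K$, with $L=K(\alpha)$ and residue field $k_L$, is tame over $K$ if it is defectless (i.e. $[L:K]=e(L/K)f(L/K)$), $k_L/k$ is separable, and $e(L/K)$ is not divisible by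 $\operatorname{char}(k)$ (no condition on $e(L/K)$ if $\operatorname{char}(k)=0$). Attached valuation and secondary slopes: let $\phi_i\in K[x]$ be the minimal polynomial of $\alpha_i$ over $K$, $m_i=\deg(\phi_i)$ and $\gamma_i=v(\phi_i(\theta))$ for $0\le i\le r$. For each $i$ let $$\mu_i\colon K[x]\to\mathbb{Q}\Gamma\cup\{\infty\},\qquad \mu_i\Big(\sum_{s\ge0}a_s\phi_i^s\Big)=\min_s\{v(a_s(\theta))+s\gamma_i\},\quad \deg(a_s)<m_i.$$ It is known that each $\mu_i$ is a valuation, that $\mu_i$ is the augmentation $[\mu_{i-1};\phi_i,\gamma_i]$ of $\mu_{i-1}$ for $0<i\le r$ (that is, $\mu_i(\sum_s a_s\phi_i^s)=\min_s\{\mu_{i-1}(a_s)+s\gamma_i\}$, where $\phi_i$ is a MacLane key polynomial for $\mu_{i-1}$ and $\gamma_i>\mu_{i-1}(\phi_i)$), and that $\mu_0,\dots,\mu_r$ form an optimal MacLane chain of the inductive valuation $\mu_F:=\mu_r$, which depends only on $F$. The slopes are $\gamma_i=\mu_i(\phi_i)$ and the secondary slopes are $$\lambda_0=\gamma_0,\qquad \lambda_i=\mu_i(\phi_i)-\mu_{i-1}(\phi_i),\quad 0<i\le r;$$ these depend only on $\mu_F$ and not on the choice of optimal MacLane chain. *)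

theory Defs
  imports
    "HOL-Algebra.Algebraic_Closure_Type"
    "HOL-Algebra.Generated_Fields"
    "HOL-Library.Extended"
    "HOL-Library.Set_Algebras"
begin

section \<open>Valuations\<close>

text \<open>
  Values lie in \<open>'g \<union> {\<infinity>}\<close> for a linearly ordered abelian group \<open>'g\<close>. The library type
  \<open>'g extended\<close> has a second infinite element \<open>-\<infinity>\<close>, which a valuation must not attain.
\<close>

definition valuation :: "('a::field \<Rightarrow> 'g::linordered_ab_group_add extended) \<Rightarrow> bool" where
  "valuation v \<longleftrightarrow>
     (\<forall>x. v x \<noteq> -\<infinity>) \<and>
     (\<forall>x. v x = \<infinity> \<longleftrightarrow> x = 0) \<and>
     (\<forall>x y. v (x * y) = v x + v y) \<and>
     (\<forall>x y. min (v x) (v y) \<le> v (x + y))"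

definition extends_to_closure ::
  "('k::field \<Rightarrow> 'g::linordered_ab_group_add extended) \<Rightarrow> ('k alg_closure \<Rightarrow> 'g extended) \<Rightarrow> bool" where
  "extends_to_closure vK v \<longleftrightarrow> valuation v \<and> (\<forall>a. v (to_ac a) = vK a)"

text \<open>
  \<open>vK\<close> is henselian on the field \<open>'k\<close> and \<open>v\<close> is its unique extension to the algebraic closure.
  The group \<open>'g\<close> need not equal \<open>\<rat>\<Gamma>\<close>: the values of \<open>v\<close> on nonzero elements form a
  divisible hull \<open>\<rat>\<Gamma>\<close> of the value group \<open>\<Gamma>\<close> of \<open>vK\<close> inside \<open>'g\<close>. As every
  extension of \<open>vK\<close> to the algebraic closure has values in a divisible hull of \<open>\<Gamma>\<close>, and
  divisible hulls are uniquely isomorphic over \<open>\<Gamma>\<close>, uniqueness among \<open>'g\<close>-valued extensions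
  is uniqueness among all extensions up to equivalence.
\<close>

definition henselian_valued_field ::
  "('k::field \<Rightarrow> 'g::linordered_ab_group_add extended) \<Rightarrow> ('k alg_closure \<Rightarrow> 'g extended) \<Rightarrow> bool" where
  "henselian_valued_field vK v \<longleftrightarrow>
     valuation vK \<and> extends_to_closure vK v \<and> (\<forall>w. extends_to_closure vK w \<longrightarrow> w = v)"


section \<open>Simple extensions of the base field\<close>

abbreviation closure_ring :: "'k::field alg_closure ring" where
  "closure_ring \<equiv> ring_of_type_algebra"

abbreviation base_field :: "'k::field alg_closure set" where
  "base_field \<equiv> range to_ac"

definition adjoin :: "'k::field alg_closure \<Rightarrow> 'k alg_closure set" where
  "adjoin \<alpha> = generate_field closure_ring (insert \<alpha> base_field)"

definition ext_degree :: "'k::field alg_closure set \<Rightarrow> nat" where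
  "ext_degree L = ring.dim closure_ring base_field L"

definition degK :: "'k::field alg_closure \<Rightarrow> nat" where
  "degK \<alpha> = ext_degree (adjoin \<alpha>)"

definition eval_ac :: "'k::field poly \<Rightarrow> 'k alg_closure \<Rightarrow> 'k alg_closure" where
  "eval_ac p x = poly (map_poly to_ac p) x"

definition min_polyK :: "'k::field alg_closure \<Rightarrow> 'k poly" where
  "min_polyK \<alpha> =
     (THE p. Polynomial.lead_coeff p = 1 \<and> Factorial_Ring.irreducible p \<and> eval_ac p \<alpha> = 0)"


section \<open>Tame elements\<close>

definition value_group ::
  "('k::field alg_closure \<Rightarrow> 'g::linordered_ab_group_add extended) \<Rightarrow> 'k alg_closure set \<Rightarrow> 'g set" where
  "value_group v L = {\<gamma>. \<exists>x\<in>L - {0}. v x = Fin \<gamma>}"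

definition ramification_index ::
  "('k::field alg_closure \<Rightarrow> 'g::linordered_ab_group_add extended) \<Rightarrow> 'k alg_closure set \<Rightarrow> nat" where
  "ramification_index v L = card ((\<lambda>\<gamma>. \<gamma> +o value_group v base_field) ` value_group v L)"

definition valuation_ring ::
  "('k::field alg_closure \<Rightarrow> 'g::linordered_ab_group_add extended) \<Rightarrow> 'k alg_closure ring" where
  "valuation_ring v = closure_ring\<lparr>carrier := {x. 0 \<le> v x}\<rparr>"

definition valuation_ideal ::
  "('k::field alg_closure \<Rightarrow> 'g::linordered_ab_group_add extended) \<Rightarrow> 'k alg_closure set" where
  "valuation_ideal v = {x. 0 < v x}"

text \<open>
  \<open>residue_closure v\<close> is the residue field of the whole algebraic closure; it is an algebraic
  closure of \<open>k\<close>. The residue field \<open>k\<^sub>L\<close> of an intermediate field \<open>L\<close> is regarded as a subfield of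
  it, via the canonical embedding induced by the inclusion of valuation rings. In particular \<open>k\<close> is
  \<open>residue_field v base_field\<close>.
\<close>

definition residue_closure ::
  "('k::field alg_closure \<Rightarrow> 'g::linordered_ab_group_add extended) \<Rightarrow> 'k alg_closure set ring" where
  "residue_closure v = valuation_ring v Quot valuation_ideal v"

definition residue_field ::
  "('k::field alg_closure \<Rightarrow> 'g::linordered_ab_group_add extended) \<Rightarrow>
   'k alg_closure set \<Rightarrow> 'k alg_closure set set" where
  "residue_field v L =
     (\<lambda>x. valuation_ideal v +>\<^bsub>valuation_ring v\<^esub> x) ` {x \<in> L. 0 \<le> v x}"

definition residue_degree ::
  "('k::field alg_closure \<Rightarrow> 'g::linordered_ab_group_add extended) \<Rightarrow> 'k alg_closure set \<Rightarrow> nat" where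
  "residue_degree v L =
     ring.dim (residue_closure v) (residue_field v base_field) (residue_field v L)"

definition residue_separable ::
  "('k::field alg_closure \<Rightarrow> 'g::linordered_ab_group_add extended) \<Rightarrow> 'k alg_closure set \<Rightarrow> bool" where
  "residue_separable v L \<longleftrightarrow>
     (\<forall>\<xi>\<in>residue_field v L. \<forall>\<zeta>\<in>carrier (residue_closure v).
        ring.alg_mult (residue_closure v)
          (ring.Irr (residue_closure v) (residue_field v base_field) \<xi>) \<zeta> \<le> 1)"

text \<open>
  Same convention as \<^const>\<open>semiring_char\<close>: the set always contains \<open>0\<close>, and its greatest common
  divisor is \<open>0\<close> if it contains nothing else.
\<close>

definition residue_char ::
  "('k::field alg_closure \<Rightarrow> 'g::linordered_ab_group_add extended) \<Rightarrow> nat" where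
  "residue_char v =
     Gcd {n. add_pow (residue_closure v) n \<one>\<^bsub>residue_closure v\<^esub> = \<zero>\<^bsub>residue_closure v\<^esub>}"

definition tame ::
  "('k::field alg_closure \<Rightarrow> 'g::linordered_ab_group_add extended) \<Rightarrow> 'k alg_closure \<Rightarrow> bool" where
  "tame v \<alpha> \<longleftrightarrow>
     (let L = adjoin \<alpha> in
        ext_degree L = ramification_index v L * residue_degree v L \<and>
        residue_separable v L \<and>
        (residue_char v = 0 \<or> \<not> residue_char v dvd ramification_index v L))"


section \<open>Complete Okutsu sequences\<close>

definition complete_okutsu_sequence ::
  "('k::field alg_closure \<Rightarrow> 'g::linordered_ab_group_add extended) \<Rightarrow>
   nat \<Rightarrow> (nat \<Rightarrow> 'k alg_closure) \<Rightarrow> 'k alg_closure \<Rightarrow> bool" where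
  "complete_okutsu_sequence v r \<alpha> \<theta> \<longleftrightarrow>
     \<alpha> (r + 1) = \<theta> \<and>
     degK (\<alpha> 0) = 1 \<and>
     (\<forall>i\<le>r. degK (\<alpha> i) < degK (\<alpha> (i + 1))) \<and>
     (\<forall>\<beta>. \<forall>i\<le>r.
        (degK \<beta> < degK (\<alpha> (i + 1)) \<longrightarrow> v (\<theta> - \<beta>) \<le> v (\<theta> - \<alpha> i)) \<and>
        (degK \<beta> < degK (\<alpha> i) \<longrightarrow> v (\<theta> - \<beta>) < v (\<theta> - \<alpha> i)))"


section \<open>The attached valuation and its secondary slopes\<close>

definition expansion_coeff :: "'k::field poly \<Rightarrow> 'k poly \<Rightarrow> nat \<Rightarrow> 'k poly" where
  "expansion_coeff \<phi> f s = (f div \<phi> ^ s) mod \<phi>"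

lemma expansion_partial:
  fixes \<phi> f :: "'k::field poly"
  shows "f = (\<Sum>s<n. expansion_coeff \<phi> f s * \<phi> ^ s) + (f div \<phi> ^ n) * \<phi> ^ n"
proof (induction n)
  case (Suc n)
  have "f div \<phi> ^ n = (f div \<phi> ^ Suc n) * \<phi> + expansion_coeff \<phi> f n"
    by (metis expansion_coeff_def div_mult_mod_eq poly_div_mult_right power_Suc2)
  then have "(f div \<phi> ^ n) * \<phi> ^ n =
      expansion_coeff \<phi> f n * \<phi> ^ n + (f div \<phi> ^ Suc n) * \<phi> ^ Suc n"
    by (simp add: algebra_simps)
  with Suc show ?case
    by (simp add: algebra_simps)
qed simp

lemma expansion_coeff_eq_0:
  fixes \<phi> f :: "'k::field poly"
  assumes "0 < Polynomial.degree \<phi>" "Polynomial.degree f < s"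
  shows "expansion_coeff \<phi> f s = 0" and "f div \<phi> ^ s = 0"
proof -
  have "\<phi> \<noteq> 0" using assms by auto
  then have "Polynomial.degree (\<phi> ^ s) = s * Polynomial.degree \<phi>"
    by (simp add: degree_power_eq)
  also have "s \<le> \<dots>" using assms by simp
  finally show "f div \<phi> ^ s = 0" using assms by (simp add: div_poly_less)
  then show "expansion_coeff \<phi> f s = 0" by (simp add: expansion_coeff_def)
qed

text \<open>
  The coefficients are those of the \<open>\<phi>\<close>-adic expansion of \<open>f\<close>, which has no terms of exponent
  larger than the degree of \<open>f\<close>.
\<close>

lemma expansion:
  fixes \<phi> f :: "'k::field poly"
  assumes "0 < Polynomial.degree \<phi>"
  shows "f = (\<Sum>s\<le>Polynomial.degree f. expansion_coeff \<phi> f s * \<phi> ^ s)"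
    and "Polynomial.degree (expansion_coeff \<phi> f s) < Polynomial.degree \<phi>"
proof -
  show "f = (\<Sum>s\<le>Polynomial.degree f. expansion_coeff \<phi> f s * \<phi> ^ s)"
    using expansion_partial[of f \<phi> "Suc (Polynomial.degree f)"]
      expansion_coeff_eq_0(2)[OF assms, of f "Suc (Polynomial.degree f)"]
    by (simp add: lessThan_Suc_atMost)
  have "\<phi> \<noteq> 0" using assms by auto
  then show "Polynomial.degree (expansion_coeff \<phi> f s) < Polynomial.degree \<phi>"
    unfolding expansion_coeff_def
    using assms degree_mod_less[of \<phi> "f div \<phi> ^ s"] by force
qed

text \<open>
  The multiple \<open>s\<gamma>\<close> of a value by a natural number is written as a sum of \<open>s\<close> copies of \<open>\<gamma>\<close>.
  Zero coefficients contribute the value \<open>\<infinity>\<close> to the minimum.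
\<close>

definition expansion_valuation ::
  "('k::field alg_closure \<Rightarrow> 'g::linordered_ab_group_add extended) \<Rightarrow> 'k alg_closure \<Rightarrow>
   'k poly \<Rightarrow> 'k poly \<Rightarrow> 'g extended" where
  "expansion_valuation v \<theta> \<phi> f =
     (MIN s\<in>{..Polynomial.degree f}.
        v (eval_ac (expansion_coeff \<phi> f s) \<theta>) + (\<Sum>j<s. v (eval_ac \<phi> \<theta>)))"

definition chain_poly :: "(nat \<Rightarrow> 'k::field alg_closure) \<Rightarrow> nat \<Rightarrow> 'k poly" where
  "chain_poly \<alpha> i = min_polyK (\<alpha> i)"

definition chain_valuation ::
  "('k::field alg_closure \<Rightarrow> 'g::linordered_ab_group_add extended) \<Rightarrow> 'k alg_closure \<Rightarrow>
   (nat \<Rightarrow> 'k alg_closure) \<Rightarrow> nat \<Rightarrow> 'k poly \<Rightarrow> 'g extended" where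
  "chain_valuation v \<theta> \<alpha> i = expansion_valuation v \<theta> (chain_poly \<alpha> i)"

text \<open>
  For a complete Okutsu sequence \<open>\<alpha> 0, \<dots>, \<alpha> r\<close> for \<open>\<theta>\<close>, the valuations
  \<open>chain_valuation v \<theta> \<alpha> 0, \<dots>, chain_valuation v \<theta> \<alpha> r\<close> form an optimal MacLane chain ending in
  \<open>\<mu>\<^sub>F\<close>, for \<open>F\<close> the minimal polynomial of \<open>\<theta>\<close>. The secondary slopes of \<open>\<mu>\<^sub>F\<close> are
  read off this chain.
\<close>

definition secondary_slope ::
  "('k::field alg_closure \<Rightarrow> 'g::linordered_ab_group_add extended) \<Rightarrow> 'k alg_closure \<Rightarrow>
   (nat \<Rightarrow> 'k alg_closure) \<Rightarrow> nat \<Rightarrow> 'g extended" where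
  "secondary_slope v \<theta> \<alpha> i =
     (if i = 0 then chain_valuation v \<theta> \<alpha> 0 (chain_poly \<alpha> 0)
      else chain_valuation v \<theta> \<alpha> i (chain_poly \<alpha> i)
             - chain_valuation v \<theta> \<alpha> (i - 1) (chain_poly \<alpha> i))"

end

theory Submission
  imports Defs
begin

text \<open>
  Fix \<open>i \<ge> 1\<close>, write \<open>c = \<alpha> (i - 1)\<close>, \<open>\<delta> = v (\<theta> - c)\<close>, and let \<open>t\<close> be a generic point at distance
  \<open>\<delta>\<close> from \<open>c\<close>. Evaluation at \<open>t\<close> computes \<open>\<mu>\<^sub>i\<^sub>-\<^sub>1\<close>. Factor \<open>\<phi>\<^sub>i = (x - \<alpha>\<^sub>i) q\<close> over the closure.
  If every root \<open>y\<close> of \<open>q\<close> satisfies \<open>v (\<alpha>\<^sub>i - y) \<le> \<delta>\<close>, then \<open>v (q \<theta>) = v (q t)\<close>, and therefore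
  \<open>\<lambda>\<^sub>i = v (\<phi>\<^sub>i \<theta>) - v (\<phi>\<^sub>i t) = v (\<theta> - \<alpha>\<^sub>i) - \<delta>\<close>.

  To bound the roots of \<open>q\<close>, suppose \<open>v (\<alpha>\<^sub>i - y) > \<delta>\<close>. Then \<open>f y\<close> and \<open>f \<alpha>\<^sub>i\<close> have the same leading
  term for all \<open>f \<in> K[x]\<close>, and the divided difference \<open>D f = f[\<alpha>\<^sub>i, y]\<close> is, to leading order, a
  derivation on \<open>K(\<alpha>\<^sub>i)\<close>; the case \<open>y = \<alpha>\<^sub>i\<close> of an inseparable \<open>\<phi>\<^sub>i\<close> is included. The \<open>\<phi>\<close>-adic
  expansions make \<open>K(\<alpha>\<^sub>i)\<close> an orthogonal space over \<open>K\<close>, so \<open>v (D f) - v (f \<alpha>\<^sub>i)\<close> attains its minimum.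
  The leading term of \<open>D\<close> vanishes on units because the residue extension is separable, and then
  everywhere because the ramification index is prime to the residue characteristic, which
  contradicts minimality. Values and residues of \<open>K(\<alpha>\<^sub>i)\<close> also occur in \<open>K(\<alpha>\<^sub>r)\<close>, so tameness of
  \<open>\<alpha>\<^sub>r\<close> suffices.
\<close>

section \<open>Polynomials over an algebraically closed valued field\<close>

locale valued_field =
  fixes v :: "'a::field \<Rightarrow> 'g::linordered_ab_group_add extended"
  assumes val: "valuation v"
begin

lemma not_Minf [simp]: "v x \<noteq> -\<infinity>"
  using val by (simp add: valuation_def)

lemma eq_Pinf_iff [simp]: "v x = \<infinity> \<longleftrightarrow> x = 0"
  using val by (simp add: valuation_def)

lemma v_0 [simp]: "v 0 = \<infinity>"
  by simp

lemma v_mult: "v (x * y) = v x + v y"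
  using val by (simp add: valuation_def)

lemma min_le_add: "min (v x) (v y) \<le> v (x + y)"
  using val by (simp add: valuation_def)

lemma FinE:
  assumes "x \<noteq> 0" obtains g where "v x = Fin g"
  using assms by (cases "v x") auto

lemma less_Pinf_iff [simp]: "v x < \<infinity> \<longleftrightarrow> x \<noteq> 0"
  by (metis eq_Pinf_iff le_Pinf less_le)

lemma v_1 [simp]: "v 1 = 0"
proof -
  obtain g where g: "v 1 = Fin g" by (rule FinE[of 1]) auto
  have "v 1 = v 1 + v 1" using v_mult[of 1 1] by simp
  then show ?thesis using g by (simp add: zero_extended_def)
qed

lemma v_minus [simp]: "v (- x) = v x"
proof -
  obtain g where g: "v (-1) = Fin g" by (rule FinE[of "-1"]) auto
  have "v (-1) + v (-1) = 0" using v_mult[of "-1" "-1"] by simp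
  then have "g + g = 0" using g by (simp add: zero_extended_def)
  then have "v (-1) = 0" using g by (simp add: zero_extended_def)
  then show ?thesis using v_mult[of "-1" x] by simp
qed

lemma v_diff_commute: "v (x - y) = v (y - x)"
  using v_minus[of "x - y"] by simp

lemma le_add: "c \<le> v x \<Longrightarrow> c \<le> v y \<Longrightarrow> c \<le> v (x + y)"
  using min_le_add[of x y] by (meson min.bounded_iff order_trans)

lemma le_diff: "c \<le> v x \<Longrightarrow> c \<le> v y \<Longrightarrow> c \<le> v (x - y)"
  using le_add[of c x "- y"] by simp

lemma less_add: "c < v x \<Longrightarrow> c < v y \<Longrightarrow> c < v (x + y)"
  using min_le_add[of x y] by (meson less_le_trans min_less_iff_conj)

lemma less_diff: "c < v x \<Longrightarrow> c < v y \<Longrightarrow> c < v (x - y)"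
  using less_add[of c x "- y"] by simp

lemma le_sum: "(\<And>i. i \<in> I \<Longrightarrow> c \<le> v (f i)) \<Longrightarrow> c \<le> v (sum f I)"
  by (induction I rule: infinite_finite_induct) (auto intro: le_add)

lemma less_sum: "c < \<infinity> \<Longrightarrow> (\<And>i. i \<in> I \<Longrightarrow> c < v (f i)) \<Longrightarrow> c < v (sum f I)"
  by (induction I rule: infinite_finite_induct) (auto intro: less_add)

lemma add_eq_left: "v x < v y \<Longrightarrow> v (x + y) = v x"
  using le_add[of "v x" x y] less_diff[of "v x" "x + y" y] by force

lemma eq_of_diff_less: "v x < v (x - y) \<Longrightarrow> v y = v x"
  using add_eq_left[of x "y - x"] by (simp add: v_diff_commute)

lemma mult_mono: "v a \<le> v b \<Longrightarrow> v c \<le> v d \<Longrightarrow> v (a * c) \<le> v (b * d)"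
  unfolding v_mult by (rule add_mono)

lemma mult_le_cancel [simp]: "c \<noteq> 0 \<Longrightarrow> v (c * x) \<le> v (c * y) \<longleftrightarrow> v x \<le> v y"
  by (erule FinE, cases "v x"; cases "v y") (auto simp: v_mult)

lemma mult_less_cancel [simp]: "c \<noteq> 0 \<Longrightarrow> v (c * x) < v (c * y) \<longleftrightarrow> v x < v y"
  by (simp flip: not_le)

lemma mult_less_le_mono:
  assumes "v a < v b" "v c \<le> v d" "c \<noteq> 0"
  shows "v (a * c) < v (b * d)"
proof -
  have "v (a * c) < v (b * c)"
    using mult_less_cancel[OF assms(3), of a b] assms(1) by (simp add: mult.commute)
  also have "\<dots> \<le> v (b * d)" by (rule mult_mono) (use assms in auto)
  finally show ?thesis .
qed

lemma v_mult_eq: "v a = v b \<Longrightarrow> v c = v d \<Longrightarrow> v (a * c) = v (b * d)"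
  by (simp add: v_mult)

lemma v_power_eq: "v a = v b \<Longrightarrow> v (a ^ n) = v (b ^ n)"
  by (induction n) (auto simp: v_mult)

lemma v_power_mono: "v a \<le> v b \<Longrightarrow> v (a ^ n) \<le> v (b ^ n)"
  by (induction n) (auto intro: mult_mono)

text \<open>Typical use: two points differ by something of value at least \<open>d\<close>, and
  neither is closer than \<open>d\<close> to a given root; then both are equally far from that
  root.\<close>

lemma eq_of_le_of_diff: 
  assumes "v x \<le> d" "v y \<le> d" "d \<le> v (x - y)"
  shows "v x = v y"
proof (rule antisym)
  show "v x \<le> v y" using le_diff[of "v x" x "x - y"] assms by auto
  show "v y \<le> v x" using le_add[of "v y" "x - y" y] assms by auto
qed

lemma integral_mult: "0 \<le> v x \<Longrightarrow> 0 \<le> v y \<Longrightarrow> 0 \<le> v (x * y)"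
  using mult_mono[of 1 x 1 y] by simp

lemma integral_power: "0 \<le> v x \<Longrightarrow> 0 \<le> v (x ^ n)"
  using v_power_mono[of 1 x n] by simp

lemma integral_of_nat: "0 \<le> v (of_nat n)"
  by (induction n) (auto intro!: le_add)

lemma v_inverse: "x \<noteq> 0 \<Longrightarrow> v (inverse x) = - v x"
proof -
  assume x: "x \<noteq> 0"
  obtain g h where gh: "v x = Fin g" "v (inverse x) = Fin h"
    using FinE[OF x] FinE[of "inverse x"] x by (metis inverse_nonzero_iff_nonzero)
  have "v x + v (inverse x) = 0" using x by (simp flip: v_mult)
  then show ?thesis using gh by (simp add: zero_extended_def add_eq_0_iff)
qed

lemma integral_poly:
  assumes "\<And>i. 0 \<le> v (poly.coeff p i)" "0 \<le> v x"
  shows "0 \<le> v (poly p x)"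
  unfolding poly_altdef by (intro le_sum integral_mult integral_power assms)

end

text \<open>Peeling off one linear factor at a time suits hypotheses about all roots, because the
  roots of \<open>q\<close> are also roots of the product.\<close>

lemma poly_root_induct [consumes 1, case_names const mult]:
  fixes p :: "'a::alg_closed_field poly"
  assumes "p \<noteq> 0"
    and "\<And>c. c \<noteq> 0 \<Longrightarrow> P [:c:]"
    and "\<And>a q. q \<noteq> 0 \<Longrightarrow> P q \<Longrightarrow> P ([:- a, 1:] * q)"
  shows "P p"
  using assms(1)
proof (induction "Polynomial.degree p" arbitrary: p)
  case 0
  then obtain c where "p = [:c:]" by (metis degree_0_id)
  then show ?case using 0 assms(2) by auto
next
  case (Suc n)
  then obtain a where "poly p a = 0" using alg_closed_imp_poly_has_root[of p] by auto
  then obtain q where q: "p = [:- a, 1:] * q" by (metis dvdE poly_eq_0_iff_dvd)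
  then have "q \<noteq> 0" using Suc by auto
  moreover have "Polynomial.degree q = n"
    using Suc(2) \<open>q \<noteq> 0\<close> unfolding q by (subst (asm) degree_mult_eq) auto
  ultimately show ?case using Suc(1) assms(3) q by metis
qed

section \<open>Values of polynomials through their linear factors, and generic points\<close>

locale closed_valued_field = valued_field v
  for v :: "'a::alg_closed_field \<Rightarrow> 'g::linordered_ab_group_add extended"
begin

text \<open>When \<open>y\<close> is nearer to \<open>x\<close> than every root is, each linear
  factor keeps its leading term, and so does the product:
  \<open>(x - a) * q x - (y - a) * q y\<close> is the sum of \<open>(y - a) * (q x - q y)\<close>
  and \<open>(x - y) * q x\<close>, both of larger value.\<close>

lemma poly_close:
  assumes "p \<noteq> 0" "\<And>\<beta>. poly p \<beta> = 0 \<Longrightarrow> v (x - \<beta>) < v (x - y)"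
  shows "v (poly p x) < v (poly p x - poly p y)"
  using assms
proof (induction rule: poly_root_induct)
  case (const c)
  then show ?case by simp
next
  case (mult a q)
  have a: "v (x - a) < v (x - y)" using mult(3)[of a] by simp
  have q: "v (poly q x) < v (poly q x - poly q y)" using mult by simp
  have qx: "poly q x \<noteq> 0" using q by auto
  have xa: "x \<noteq> a" using a by auto
  have eq: "v (y - a) = v (x - a)"
    using eq_of_diff_less[of "x - a" "y - a"] a by simp
  have "poly ([:- a, 1:] * q) x - poly ([:- a, 1:] * q) y =
      (y - a) * (poly q x - poly q y) + (x - y) * poly q x"
    by (simp add: algebra_simps)
  moreover have "v (poly ([:- a, 1:] * q) x) = v ((x - a) * poly q x)"
    by (simp add: algebra_simps)
  moreover have "v ((x - a) * poly q x) < v ((y - a) * (poly q x - poly q y))"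
    using mult_less_le_mono[of "poly q x" "poly q x - poly q y" "x - a" "y - a"] q eq xa
    by (simp add: mult.commute)
  moreover have "v ((x - a) * poly q x) < v ((x - y) * poly q x)"
    using mult_less_le_mono[OF a order_refl qx] .
  ultimately show ?case by (metis less_add)
qed

lemma poly_mono:
  assumes "\<And>\<beta>. poly p \<beta> = 0 \<Longrightarrow> v (x - \<beta>) \<le> v (y - \<beta>)"
  shows "v (poly p x) \<le> v (poly p y)"
proof (cases "p = 0")
  case False
  then show ?thesis using assms
  proof (induction rule: poly_root_induct)
    case (mult a q)
    have "v ((x - a) * poly q x) \<le> v ((y - a) * poly q y)"
      by (rule mult_mono) (use mult in auto)
    then show ?case by (simp add: algebra_simps)
  qed simp
qed simp

lemma poly_cong:
  assumes "\<And>\<beta>. poly p \<beta> = 0 \<Longrightarrow> v (x - \<beta>) = v (y - \<beta>)"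
  shows "v (poly p x) = v (poly p y)"
  by (rule antisym; rule poly_mono) (use assms in auto)

text \<open>A Newton polygon argument: if \<open>y\<close> is no closer to a root than to
  \<open>0\<close>, the terms of \<open>poly g y\<close> do not cancel. A factor
  \<open>x - a\<close> satisfies both \<open>v (y - a) \<le> v y\<close> and
  \<open>v (y - a) \<le> v a\<close>, and a coefficient of the product combines a shifted
  coefficient of \<open>q\<close> with \<open>a\<close> times an unshifted one.\<close>

lemma poly_le_term:
  assumes "g \<noteq> 0" "\<And>\<eta>. poly g \<eta> = 0 \<Longrightarrow> v (y - \<eta>) \<le> v y"
  shows "v (poly g y) \<le> v (poly.coeff g s * y ^ s)"
  using assms
proof (induction arbitrary: s rule: poly_root_induct)
  case (const c)
  then show ?case by (cases s) auto
next
  case (mult a q)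
  have IH: "v (poly q y) \<le> v (poly.coeff q s * y ^ s)" for s using mult by simp
  have a: "v (y - a) \<le> v y" using mult(3)[of a] by simp
  then have a': "v (y - a) \<le> v a"
    using le_diff[of "v (y - a)" y "y - a"] by simp
  have e: "v (poly ([:- a, 1:] * q) y) = v ((y - a) * poly q y)"
    by (simp add: algebra_simps)
  have 1: "v ((y - a) * poly q y) \<le> v (a * (poly.coeff q s * y ^ s))"
    by (rule mult_mono[OF a' IH])
  show ?case
  proof (cases s)
    case 0
    then show ?thesis using 1 unfolding e by simp
  next
    case (Suc s')
    have "v ((y - a) * poly q y) \<le> v (y * (poly.coeff q s' * y ^ s'))"
      by (rule mult_mono[OF a IH])
    then have "v ((y - a) * poly q y) \<le> v (y * (poly.coeff q s' * y ^ s') - a * (poly.coeff q s * y ^ s))"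
      using 1 by (rule le_diff)
    then show ?thesis unfolding e by (simp add: Suc algebra_simps)
  qed
qed

text \<open>A root \<open>w\<close> of \<open>x \<cdot> \<Prod>(x - z) - 1\<close> has a residue different from \<open>0\<close> and from all the given ones.\<close>

lemma infinite_residues:
  "\<exists>Z. finite Z \<and> card Z = n \<and> (\<forall>z\<in>Z. v z = 0) \<and> (\<forall>z\<in>Z. \<forall>w\<in>Z. z \<noteq> w \<longrightarrow> v (z - w) = 0)"
proof (induction n)
  case 0
  then show ?case by (intro exI[of _ "{}"]) auto
next
  case (Suc n)
  then obtain Z where Z: "finite Z" "card Z = n" "\<forall>z\<in>Z. v z = 0"
    "\<forall>z\<in>Z. \<forall>w\<in>Z. z \<noteq> w \<longrightarrow> v (z - w) = 0" by blast
  define p where "p = [:0, 1:] * (\<Prod>z\<in>Z. [:- z, 1:])"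
  have p0: "(\<Prod>z\<in>Z. [:- z, 1:]) \<noteq> (0 :: 'a poly)" by (simp add: Z)
  have "Polynomial.degree p > 0"
    unfolding p_def by (subst degree_mult_eq) (use p0 in auto)
  then have "Polynomial.degree (p - 1) > 0"
    by (metis degree_1 degree_add_eq_left diff_conv_add_uminus degree_minus)
  then obtain w where w: "poly (p - 1) w = 0" using alg_closed_imp_poly_has_root by blast
  then have w1: "w * (\<Prod>z\<in>Z. w - z) = 1" by (simp add: p_def poly_prod)
  \<comment> \<open>If \<open>w\<close> had negative value, so would every factor
    \<open>w - z\<close>, and the product could not be \<open>1\<close>.\<close>
  have int: "0 \<le> v w"
  proof (rule ccontr)
    assume "\<not> 0 \<le> v w"
    then have neg: "v w < 0" by simp
    have le: "v (w - z) < 0" if "z \<in> Z" for z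
      using add_eq_left[of w "- z"] neg that Z by simp
    have "v (\<Prod>z\<in>Z. w - z) \<le> 0"
      using Z(1) le
    proof (induction Z rule: finite_induct)
      case (insert x F)
      then have "v (w - x) < 0" "v (\<Prod>z\<in>F. w - z) \<le> 0" by auto
      then show ?case using insert(1,2) mult_mono[of "w - x" 1 "\<Prod>z\<in>F. w - z" 1] by simp
    qed simp
    then have "v (w * (\<Prod>z\<in>Z. w - z)) < v (1 * 1)"
      using w1 neg by (intro mult_less_le_mono) auto
    then show False using w1 by simp
  qed
  \<comment> \<open>All factors, including \<open>w - 0\<close>, are integral and their product is
    \<open>1\<close>, so each one is a unit.\<close>
  have unit: "v (w - z) = 0" if "z \<in> insert 0 Z" for z
  proof -
    have 0: "finite (insert 0 Z)" "0 \<notin> Z" using Z by (auto simp: zero_extended_def)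
    then have "(\<Prod>z\<in>insert 0 Z. w - z) = 1" using w1 Z by simp
    then have "(w - z) * (\<Prod>z\<in>insert 0 Z - {z}. w - z) = 1"
      using prod.remove[OF 0(1) that, of "\<lambda>z. w - z"] by simp
    then have 2: "v ((w - z) * (\<Prod>z\<in>insert 0 Z - {z}. w - z)) = 0" by simp
    have nn: "0 \<le> v (w - u)" if "u \<in> insert 0 Z" for u
      using that Z(3) int by (intro le_diff) auto
    have "0 \<le> v (\<Prod>z\<in>S. w - z)" if "finite S" "S \<subseteq> insert 0 Z" for S
      using that by (induction S rule: finite_induct) (auto intro!: integral_mult nn)
    then have "0 \<le> v (\<Prod>z\<in>insert 0 Z - {z}. w - z)" using 0(1) by auto
    then have "v (w - z) \<le> 0"
      using 2 mult_mono[of "w - z" "w - z" 1] by fastforce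
    then show ?thesis using nn[OF that] by simp
  qed
  have "w \<notin> Z" using unit[of w] by (auto simp: zero_extended_def)
  moreover have "v z = 0" if "z \<in> insert w Z" for z using unit[of 0] Z that by auto
  moreover have "v (x - y) = 0" if "x \<in> insert w Z" "y \<in> insert w Z" "x \<noteq> y" for x y
    using that unit[of x] unit[of y] Z(4) v_diff_commute[of w] by auto
  ultimately show ?case using Z by (intro exI[of _ "insert w Z"]) auto
qed

text \<open>Pigeonhole: among the points \<open>c + d * z\<close>, one more in number than
  \<open>B\<close> has elements, any two differ by exactly the value of \<open>d\<close>, so a given
  \<open>\<beta>\<close> can be too close to at most one of them.\<close>

lemma generic_point:
  assumes "finite B" "d \<noteq> 0"
  obtains t where "v (t - c) = v d" "\<And>\<beta>. \<beta> \<in> B \<Longrightarrow> v (t - \<beta>) \<le> v d"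
proof -
  obtain Z where Z: "finite Z" "card Z = Suc (card B)" "\<forall>z\<in>Z. v z = 0"
    "\<forall>z\<in>Z. \<forall>w\<in>Z. z \<noteq> w \<longrightarrow> v (z - w) = 0" using infinite_residues by blast
  define T where "T = (\<lambda>z. c + d * z) ` Z"
  have T: "v (t - c) = v d" if "t \<in> T" for t
    using that Z(3) by (auto simp: T_def v_mult)
  have "\<exists>t\<in>T. \<forall>\<beta>\<in>B. v (t - \<beta>) \<le> v d"
  proof (rule ccontr)
    assume "\<not> ?thesis"
    then have "\<forall>z\<in>Z. \<exists>\<beta>\<in>B. v d < v (c + d * z - \<beta>)" by (force simp: T_def)
    then obtain b where b: "\<And>z. z \<in> Z \<Longrightarrow> b z \<in> B \<and> v d < v (c + d * z - b z)" by metis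
    have "inj_on b Z"
    proof (rule inj_onI, rule ccontr)
      fix z w assume zw: "z \<in> Z" "w \<in> Z" "b z = b w" "z \<noteq> w"
      then have "v d < v ((c + d * z - b z) - (c + d * w - b w))"
        by (intro less_diff conjunct2[OF b] zw)
      also have "(c + d * z - b z) - (c + d * w - b w) = d * (z - w)"
        using zw by (simp add: algebra_simps)
      finally show False using Z(4) zw by (simp add: v_mult)
    qed
    then have "card Z \<le> card B" using b assms(1) by (intro card_inj_on_le[of b]) auto
    then show False using Z by simp
  qed
  then show ?thesis using T that by blast
qed


text \<open>
  Near \<open>c\<close> the coefficients \<open>a s\<close> are constant to leading order, so the expansion behaves like the
  polynomial \<open>g = \<Sum> (a s)(c) y\<^sup>s\<close> at \<open>y = \<phi> t\<close>. Taking \<open>t\<close> generic also for the roots of \<open>\<phi> - \<eta>\<close>, for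
  all roots \<open>\<eta>\<close> of \<open>g\<close>, excludes cancellation in \<open>g\<close>.
\<close>

lemma generic_expansion:
  assumes "\<theta> \<noteq> c" and \<phi>: "0 < Polynomial.degree \<phi>" "poly \<phi> c = 0"
    and \<phi>_root: "\<And>\<beta>. poly \<phi> \<beta> = 0 \<Longrightarrow> v (\<theta> - \<beta>) \<le> v (\<theta> - c)"
    and a_root: "\<And>s \<beta>. s \<in> S \<Longrightarrow> a s \<noteq> 0 \<Longrightarrow> poly (a s) \<beta> = 0 \<Longrightarrow> v (\<theta> - \<beta>) < v (\<theta> - c)"
    and "finite S" "finite B"
  obtains t where "v (t - c) = v (\<theta> - c)" "\<And>\<beta>. \<beta> \<in> B \<Longrightarrow> v (t - \<beta>) \<le> v (\<theta> - c)"
    "\<And>s. s \<in> S \<Longrightarrow> v (poly (a s) t * poly \<phi> t ^ s) = v (poly (a s) \<theta> * poly \<phi> \<theta> ^ s)"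
    "\<And>s. s \<in> S \<Longrightarrow> v (poly (\<Sum>s\<in>S. a s * \<phi> ^ s) t) \<le> v (poly (a s) \<theta> * poly \<phi> \<theta> ^ s)"
proof -
  define g where "g = (\<Sum>s\<in>S. Polynomial.monom (poly (a s) c) s)"
  \<comment> \<open>Besides \<open>B\<close>, the point must avoid the roots of
    \<open>\<phi>\<close> and the preimages under \<open>\<phi>\<close> of the roots of
    \<open>g\<close>. For \<open>g = 0\<close> everything is a root, so that part is left out to
    keep the set finite.\<close>
  define B' where "B' = B \<union> {\<beta>. poly \<phi> \<beta> = 0} \<union>
    (\<Union>\<eta>\<in>(if g = 0 then {} else {\<eta>. poly g \<eta> = 0}). {\<tau>. poly (\<phi> - [:\<eta>:]) \<tau> = 0})"
  have nz: "\<phi> \<noteq> 0" "\<phi> - [:\<eta>:] \<noteq> 0" for \<eta>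
    using \<phi>(1) by auto
  have "finite B'"
    unfolding B'_def using assms(7) by (intro finite_UnI finite_UN_I poly_roots_finite nz)
      (simp_all add: poly_roots_finite)
  then obtain t where t: "v (t - c) = v (\<theta> - c)" "\<And>\<beta>. \<beta> \<in> B' \<Longrightarrow> v (t - \<beta>) \<le> v (\<theta> - c)"
    using generic_point[of B' "\<theta> - c" c] assms(1) by auto
  have t\<theta>: "v (\<theta> - c) \<le> v (t - \<theta>)"
    using le_diff[of "v (\<theta> - c)" "t - c" "\<theta> - c"] t(1) by simp
  have \<phi>_t: "v (poly \<phi> t) = v (poly \<phi> \<theta>)"
  proof (rule poly_cong)
    fix \<beta> assume \<beta>: "poly \<phi> \<beta> = 0"
    show "v (t - \<beta>) = v (\<theta> - \<beta>)"
      by (rule eq_of_le_of_diff[of _ "v (\<theta> - c)"]) (use \<beta> \<phi>_root t(2) t\<theta> in \<open>auto simp: B'_def\<close>)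
  qed
  have \<phi>_t0: "poly \<phi> t \<noteq> 0"
  proof
    assume "poly \<phi> t = 0"
    then have "poly \<phi> \<theta> = 0" using \<phi>_t by (metis eq_Pinf_iff)
    then show False using \<phi>_root[of \<theta>] assms(1) by simp
  qed
  have near: "v (poly (a s) c) < v (poly (a s) c - poly (a s) x)"
    if s: "s \<in> S" "a s \<noteq> 0" and x: "v (\<theta> - c) \<le> v (x - c)" for s x
  proof (rule poly_close[OF s(2)])
    fix \<beta> assume "poly (a s) \<beta> = 0"
    then have lt: "v (\<theta> - \<beta>) < v (\<theta> - c)" using a_root s by blast
    then have "v (c - \<beta>) = v (\<theta> - \<beta>)"
      using eq_of_diff_less[of "\<theta> - \<beta>" "c - \<beta>"] by simp
    then show "v (c - \<beta>) < v (c - x)" using lt x v_diff_commute[of c x] by simp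
  qed
  have a_eq: "v (poly (a s) x) = v (poly (a s) c)" if s: "s \<in> S" and x: "v (\<theta> - c) \<le> v (x - c)" for s x
    using eq_of_diff_less[OF near[OF s _ x]] by (cases "a s = 0") auto
  have term_t: "v (poly (a s) t * poly \<phi> t ^ s) = v (poly (a s) \<theta> * poly \<phi> \<theta> ^ s)" if "s \<in> S" for s
    using a_eq[OF that, of t] a_eq[OF that, of \<theta>] t(1) \<phi>_t by (intro v_mult_eq v_power_eq) auto
  have term_c: "v (poly (a s) c * poly \<phi> t ^ s) = v (poly (a s) \<theta> * poly \<phi> \<theta> ^ s)" if "s \<in> S" for s
    using a_eq[OF that, of \<theta>] \<phi>_t by (intro v_mult_eq v_power_eq) auto
  have coeff_g: "poly.coeff g s = poly (a s) c" if "s \<in> S" for s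
    using that assms(6) by (simp add: g_def coeff_sum)
  have "v (poly (\<Sum>s\<in>S. a s * \<phi> ^ s) t) \<le> v (poly (a s) \<theta> * poly \<phi> \<theta> ^ s)" if s: "s \<in> S" for s
  proof (cases "g = 0")
    case True
    \<comment> \<open>A nonzero \<open>a s\<close> has all its roots strictly farther from
      \<open>\<theta>\<close> than \<open>c\<close>, so it cannot vanish at \<open>c\<close>; hence
      the term is zero.\<close>
    have "poly (a s) c = 0" using True coeff_g[OF s] by simp
    then have "a s = 0" using a_root[OF s, of c] by auto
    then show ?thesis by simp
  next
    case False
    \<comment> \<open>This is the hypothesis of \<open>poly_le_term\<close> at
      \<open>poly \<phi> t\<close>. Since \<open>t\<close> is no closer than \<open>c\<close> to any
      root of \<open>\<phi> - \<eta>\<close>, the value of \<open>\<phi> - \<eta>\<close> at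
      \<open>t\<close> is at most that at \<open>c\<close>, which is \<open>v \<eta>\<close>; a
      cancellation in \<open>\<phi> t - \<eta>\<close> would contradict this.\<close>
    have root: "v (poly \<phi> t - \<eta>) \<le> v (poly \<phi> t)" if \<eta>: "poly g \<eta> = 0" for \<eta>
    proof (rule ccontr)
      assume "\<not> ?thesis"
      then have gt: "v (poly \<phi> t) < v (poly \<phi> t - \<eta>)" by simp
      have "v (poly (\<phi> - [:\<eta>:]) t) \<le> v (poly (\<phi> - [:\<eta>:]) c)"
      proof (rule poly_mono)
        fix \<tau> assume "poly (\<phi> - [:\<eta>:]) \<tau> = 0"
        then have "\<tau> \<in> B'" using \<eta> False by (auto simp: B'_def)
        then have "v (t - \<tau>) \<le> v (\<theta> - c)" by (rule t(2))
        then show "v (t - \<tau>) \<le> v (c - \<tau>)"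
          using le_diff[of "v (t - \<tau>)" "t - \<tau>" "t - c"] t(1) by simp
      qed
      then have "v (poly \<phi> t - \<eta>) \<le> v \<eta>" using \<phi>(2) by simp
      with gt have "v (poly \<phi> t) < v \<eta>" by (rule less_le_trans)
      from less_add[OF gt this] show False by simp
    qed
    have g_le: "v (poly g (poly \<phi> t)) \<le> v (poly (a s) c * poly \<phi> t ^ s)" if "s \<in> S" for s
      using poly_le_term[OF False root] coeff_g[OF that] by metis
    obtain s' where s': "s' \<in> S" "poly (a s') c \<noteq> 0"
    proof (rule ccontr)
      assume "\<not> ?thesis" then show False
        using that False unfolding g_def by (metis (mono_tags, lifting) monom_eq_0 sum.neutral)
    qed
    then have "v (poly (a s') c * poly \<phi> t ^ s') < \<infinity>" using \<phi>_t0 by simp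
    with g_le[OF s'(1)] have fin: "v (poly g (poly \<phi> t)) < \<infinity>" by (rule le_less_trans)
    \<comment> \<open>Replacing the coefficients at \<open>t\<close> by those at \<open>c\<close> is
      an error of strictly larger value, so the expansion at \<open>t\<close> has the value of
      \<open>g\<close> at \<open>\<phi> t\<close>.\<close>
    have "v (poly g (poly \<phi> t)) < v (\<Sum>s\<in>S. (poly (a s) c - poly (a s) t) * poly \<phi> t ^ s)"
    proof (rule less_sum[OF fin])
      fix s assume s: "s \<in> S"
      show "v (poly g (poly \<phi> t)) < v ((poly (a s) c - poly (a s) t) * poly \<phi> t ^ s)"
      proof (cases "a s = 0")
        case True
        then show ?thesis using fin by simp
      next
        case a0: False
        have "v (poly (a s) c * poly \<phi> t ^ s) < v ((poly (a s) c - poly (a s) t) * poly \<phi> t ^ s)"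
          using near[OF s a0, of t] t(1) \<phi>_t0 by (intro mult_less_le_mono) auto
        then show ?thesis using g_le[OF s] by simp
      qed
    qed
    also have "(\<Sum>s\<in>S. (poly (a s) c - poly (a s) t) * poly \<phi> t ^ s) =
        poly g (poly \<phi> t) - poly (\<Sum>s\<in>S. a s * \<phi> ^ s) t"
      by (simp add: g_def poly_sum poly_monom sum_subtractf algebra_simps)
    finally have "v (poly (\<Sum>s\<in>S. a s * \<phi> ^ s) t) = v (poly g (poly \<phi> t))"
      by (rule eq_of_diff_less)
    then show ?thesis using g_le[OF s] term_c[OF s] by simp
  qed
  then show ?thesis
    using that[OF t(1) _ term_t] t(2) by (simp add: B'_def)
qed

text \<open>The same absence of cancellation at \<open>\<theta>\<close> itself: as \<open>f\<close>
  has no root closer to \<open>\<theta>\<close> than \<open>c\<close>, its value at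
  \<open>\<theta>\<close> agrees with that at a generic point.\<close>

lemma expansion_le_term:
  assumes "\<theta> \<noteq> c" "0 < Polynomial.degree \<phi>" "poly \<phi> c = 0"
    "\<And>\<beta>. poly \<phi> \<beta> = 0 \<Longrightarrow> v (\<theta> - \<beta>) \<le> v (\<theta> - c)"
    "\<And>s \<beta>. s \<in> S \<Longrightarrow> a s \<noteq> 0 \<Longrightarrow> poly (a s) \<beta> = 0 \<Longrightarrow> v (\<theta> - \<beta>) < v (\<theta> - c)"
    "finite S" "s \<in> S"
    and f: "f = (\<Sum>s\<in>S. a s * \<phi> ^ s)"
    and f_root: "\<And>\<beta>. f \<noteq> 0 \<Longrightarrow> poly f \<beta> = 0 \<Longrightarrow> v (\<theta> - \<beta>) \<le> v (\<theta> - c)"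
  shows "v (poly f \<theta>) \<le> v (poly (a s) \<theta> * poly \<phi> \<theta> ^ s)"
proof (cases "f = 0")
  case False
  then have fin: "finite {\<beta>. poly f \<beta> = 0}" by (rule poly_roots_finite)
  obtain t where t: "v (t - c) = v (\<theta> - c)"
      "\<And>\<beta>. \<beta> \<in> {\<beta>. poly f \<beta> = 0} \<Longrightarrow> v (t - \<beta>) \<le> v (\<theta> - c)"
      "\<And>s. s \<in> S \<Longrightarrow> v (poly f t) \<le> v (poly (a s) \<theta> * poly \<phi> \<theta> ^ s)"
    unfolding f
    by (rule generic_expansion[of \<theta> c \<phi> S a "{\<beta>. poly f \<beta> = 0}"]) (use assms(1-6) fin f in blast)+
  have "v (\<theta> - c) \<le> v (\<theta> - t)"
    using le_diff[of "v (\<theta> - c)" "\<theta> - c" "t - c"] t(1) by simp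
  then have "v (poly f \<theta>) = v (poly f t)"
    using f_root[OF False] t(2)
    by (intro poly_cong eq_of_le_of_diff[of "\<theta> - _" "v (\<theta> - c)"]) auto
  then show ?thesis using t(3)[OF assms(7)] by simp
next
  case True
  obtain t where "\<And>s. s \<in> S \<Longrightarrow> v (poly f t) \<le> v (poly (a s) \<theta> * poly \<phi> \<theta> ^ s)"
    unfolding f
    by (rule generic_expansion[of \<theta> c \<phi> S a "{}"]) (use assms(1-6) in blast)+
  from this[OF assms(7)] have t: "v (poly f t) \<le> v (poly (a s) \<theta> * poly \<phi> \<theta> ^ s)" .
  then show ?thesis using True by simp
qed

end

section \<open>Divided differences\<close>

text \<open>The quotient of \<open>f b - f a\<close> by \<open>b - a\<close>, encoded through
  polynomial division so that \<open>a = b\<close> is allowed and gives the formal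
  derivative.\<close>

definition divided_diff :: "'a::comm_ring_1 poly \<Rightarrow> 'a \<Rightarrow> 'a \<Rightarrow> 'a" where
  "divided_diff f a b = poly (synthetic_div f a) b"

text \<open>Division by the monic polynomial \<open>x - a\<close> has a unique quotient. The rules
  below follow by exhibiting a suitable decomposition.\<close>

lemma divided_diff_unique:
  fixes f :: "'a::comm_ring_1 poly"
  assumes "f = [:- a, 1:] * q + [:c:]"
  shows "divided_diff f a b = poly q b"
proof -
  have "f + smult a q = pCons c q" using assms by (simp add: algebra_simps)
  then show ?thesis using synthetic_div_unique unfolding divided_diff_def by blast
qed

lemma divided_diff_eq: "(b - a) * divided_diff f a b = poly f b - poly f a"
  for f :: "'a::comm_ring_1 poly"
proof -
  have "poly f b = poly ([:- a, 1:] * synthetic_div f a + [:poly f a:]) b"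
    by (simp only: synthetic_div_correct')
  then show ?thesis by (simp add: divided_diff_def algebra_simps)
qed

lemma divided_diff_const [simp]: "divided_diff [:c:] a b = 0"
  by (rule divided_diff_unique[of _ _ 0 c, THEN trans]) simp_all

lemma divided_diff_X [simp]: "divided_diff [:0, 1:] a b = 1"
  by (rule divided_diff_unique[of _ _ 1 a, THEN trans]) simp_all

lemma divided_diff_add: "divided_diff (f + g) a b = divided_diff f a b + divided_diff g a b"
proof -
  have *: "(l * p + c) + (l * q + d) = l * (p + q) + (c + d)" for l p q c d :: "'a poly"
    by (simp add: algebra_simps)
  have "f + g = ([:- a, 1:] * synthetic_div f a + [:poly f a:]) +
      ([:- a, 1:] * synthetic_div g a + [:poly g a:])"
    by (simp only: synthetic_div_correct')
  also have "\<dots> = [:- a, 1:] * (synthetic_div f a + synthetic_div g a) + [:poly f a + poly g a:]"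
    unfolding * by simp
  finally show ?thesis using divided_diff_unique by (metis divided_diff_def poly_add)
qed

text \<open>A twisted Leibniz rule, which is a true one to leading order as soon as values at
  \<open>a\<close> and at \<open>b\<close> agree to leading order.\<close>

lemma divided_diff_mult:
  "divided_diff (f * g) a b = divided_diff f a b * poly g b + poly f a * divided_diff g a b"
proof -
  have *: "(l * p + c) * (l * q + d) = l * (p * (l * q + d) + c * q) + c * d" for l p q c d :: "'a poly"
    by (simp add: algebra_simps)
  have const: "[:c:] * [:d:] = [:c * d:]" for c d :: 'a by simp
  have "f * g = ([:- a, 1:] * synthetic_div f a + [:poly f a:]) *
      ([:- a, 1:] * synthetic_div g a + [:poly g a:])"
    by (simp only: synthetic_div_correct')
  also have "\<dots> = [:- a, 1:] * (synthetic_div f a * g + [:poly f a:] * synthetic_div g a) +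
      [:poly f a * poly g a:]"
    by (subst *) (simp only: const synthetic_div_correct')
  finally have "divided_diff (f * g) a b =
      poly (synthetic_div f a * g + [:poly f a:] * synthetic_div g a) b"
    by (rule divided_diff_unique)
  then show ?thesis by (simp add: divided_diff_def)
qed

lemma divided_diff_smult: "divided_diff (smult c f) a b = c * divided_diff f a b"
  using divided_diff_mult[of "[:c:]" f a b] by simp

lemma divided_diff_power:
  "divided_diff (f ^ n) a b = divided_diff f a b * (\<Sum>j<n. poly f a ^ j * poly f b ^ (n - Suc j))"
proof (induction n)
  case 0
  then show ?case using divided_diff_const[of 1] by (simp add: one_pCons)
next
  case (Suc n)
  have "divided_diff (f ^ Suc n) a b = divided_diff (f ^ n * f) a b" by (simp add: mult.commute)
  also have "\<dots> = divided_diff f a b *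
      ((\<Sum>j<n. poly f a ^ j * poly f b ^ (n - Suc j)) * poly f b + poly f a ^ n)"
    unfolding divided_diff_mult Suc by (simp add: algebra_simps)
  also have "(\<Sum>j<n. poly f a ^ j * poly f b ^ (n - Suc j)) * poly f b + poly f a ^ n =
      (\<Sum>j<Suc n. poly f a ^ j * poly f b ^ (Suc n - Suc j))"
    by (simp add: sum_distrib_right mult.assoc Suc_diff_Suc flip: power_Suc2)
  finally show ?case .
qed

text \<open>The chain rule: divide \<open>h\<close> by \<open>x - f a\<close>, substitute
  \<open>f\<close>, and divide \<open>f - f a\<close> by \<open>x - a\<close>.\<close>

lemma divided_diff_pcompose:
  "divided_diff (h \<circ>\<^sub>p f) a b = divided_diff h (poly f a) (poly f b) * divided_diff f a b"
proof -
  have lin: "[:- c, 1:] \<circ>\<^sub>p f = f - [:c:]" for c by (simp add: pcompose_pCons)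
  have "h \<circ>\<^sub>p f = ([:- poly f a, 1:] * synthetic_div h (poly f a) + [:poly h (poly f a):]) \<circ>\<^sub>p f"
    by (simp only: synthetic_div_correct')
  also have "\<dots> = (f - [:poly f a:]) * (synthetic_div h (poly f a) \<circ>\<^sub>p f) + [:poly h (poly f a):]"
    by (simp only: pcompose_add pcompose_mult lin pcompose_const)
  also have "f - [:poly f a:] = [:- a, 1:] * synthetic_div f a"
    unfolding diff_eq_eq by (simp only: synthetic_div_correct')
  finally have "divided_diff (h \<circ>\<^sub>p f) a b = poly (synthetic_div f a * (synthetic_div h (poly f a) \<circ>\<^sub>p f)) b"
    by (intro divided_diff_unique) (simp only: mult.assoc)
  then show ?thesis by (simp add: divided_diff_def poly_pcompose mult.commute)
qed

section \<open>Degrees and minimal polynomials\<close>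

lemma closure_ring_simps [simp]:
  "carrier closure_ring = UNIV" "\<zero>\<^bsub>closure_ring\<^esub> = 0" "\<one>\<^bsub>closure_ring\<^esub> = 1"
  "x \<otimes>\<^bsub>closure_ring\<^esub> y = x * y" "x \<oplus>\<^bsub>closure_ring\<^esub> y = x + y"
  by (simp_all add: ring_of_type_algebra_def)

interpretation closure: domain "closure_ring :: 'k::field alg_closure ring"
  by (rule field.axioms(1)[OF field_from_type_algebra])

lemma closure_ring_minus [simp]: "\<ominus>\<^bsub>closure_ring\<^esub> x = - x" for x :: "'k::field alg_closure"
  using closure.minus_equality[of "- x" x] by simp

lemma closure_ring_inv [simp]: "x \<noteq> 0 \<Longrightarrow> inv\<^bsub>closure_ring\<^esub> x = inverse x"
  for x :: "'k::field alg_closure"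
  using closure.inv_char[of x "inverse x"] by simp

lemma closure_ring_pow [simp]: "x [^]\<^bsub>closure_ring\<^esub> (n::nat) = x ^ n" for x :: "'k::field alg_closure"
  by (induction n) (simp_all add: mult.commute)

lemma base_field_subfield: "subfield (base_field :: 'k::field alg_closure set) closure_ring"
proof (rule field.subfieldI'[OF field_from_type_algebra])
  show "subring (base_field :: 'k alg_closure set) closure_ring"
  proof (rule closure.subringI)
    show "\<one>\<^bsub>closure_ring\<^esub> \<in> (base_field :: 'k alg_closure set)"
      using rangeI[of to_ac 1] by simp
  qed (auto simp flip: to_ac_minus to_ac_mult to_ac_add)
  show "inv\<^bsub>closure_ring\<^esub> k \<in> base_field"
    if "k \<in> base_field - {\<zero>\<^bsub>closure_ring\<^esub>}" for k :: "'k alg_closure"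
    using that by (auto simp flip: to_ac_inverse)
qed

text \<open>List polynomials carry the leading coefficient first, \<open>Poly\<close> expects the
  constant one first; hence the reversal here and below.\<close>

lemma closure_eval: "closure.eval xs x = poly (Poly (rev xs)) x"
  by (induction xs) (simp_all add: Poly_append poly_monom)

lemma Poly_map_to_ac: "Poly (map to_ac xs) = map_poly to_ac (Poly xs)"
  by (rule poly_eqI) (auto simp: coeff_map_poly nth_default_def)

lemma eval_ac_Poly: "eval_ac (Poly (rev xs)) x = closure.eval (map to_ac xs) x"
  by (simp add: closure_eval eval_ac_def rev_map Poly_map_to_ac)

lemma eval_ac_eq_closure_eval: "eval_ac p x = closure.eval (map to_ac (rev (coeffs p))) x"
  using eval_ac_Poly[of "rev (coeffs p)" x] by simp

lemma map_poly_to_ac_simps [simp]: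
  "map_poly to_ac 1 = 1" "map_poly to_ac [:a:] = [:to_ac a:]"
  "map_poly to_ac (p + q) = map_poly to_ac p + map_poly to_ac q"
  "map_poly to_ac (p - q) = map_poly to_ac p - map_poly to_ac q"
  "map_poly to_ac (p * q) = map_poly to_ac p * map_poly to_ac q"
  "map_poly to_ac (smult a p) = smult (to_ac a) (map_poly to_ac p)"
  by (auto intro!: poly_eqI simp: coeff_map_poly coeff_mult to_ac_sum coeff_pCons split: nat.splits)

lemma map_poly_to_ac_power [simp]: "map_poly to_ac (p ^ n) = map_poly to_ac p ^ n"
  by (induction n) simp_all

lemma map_poly_to_ac_sum: "map_poly to_ac (sum f I) = (\<Sum>i\<in>I. map_poly to_ac (f i))"
  by (induction I rule: infinite_finite_induct) simp_all

lemma map_poly_to_ac_pCons [simp]: "map_poly to_ac (pCons a p) = pCons (to_ac a) (map_poly to_ac p)"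
  by (simp add: map_poly_pCons)

lemma map_poly_to_ac_pcompose: "map_poly to_ac (p \<circ>\<^sub>p q) = map_poly to_ac p \<circ>\<^sub>p map_poly to_ac q"
  by (induction p) (simp_all add: pcompose_pCons)

lemma degree_map_poly_to_ac [simp]: "Polynomial.degree (map_poly to_ac p) = Polynomial.degree p"
  by (rule degree_map_poly) simp

lemma map_poly_to_ac_eq_0_iff [simp]: "map_poly to_ac p = 0 \<longleftrightarrow> p = 0"
  by (rule map_poly_eq_0_iff) simp_all

lemma eval_ac_simps [simp]:
  "eval_ac 0 x = 0" "eval_ac 1 x = 1" "eval_ac [:a:] x = to_ac a"
  "eval_ac (p + q) x = eval_ac p x + eval_ac q x"
  "eval_ac (p - q) x = eval_ac p x - eval_ac q x"
  "eval_ac (p * q) x = eval_ac p x * eval_ac q x"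
  "eval_ac (smult a p) x = to_ac a * eval_ac p x"
  "eval_ac (p ^ n) x = eval_ac p x ^ n"
  by (simp_all add: eval_ac_def)

lemma poly_list_carrier:
  assumes "p \<noteq> 0"
  shows "map to_ac (rev (coeffs p)) \<in> carrier (base_field[X]\<^bsub>closure_ring\<^esub>)"
  using assms by (auto simp: univ_poly_def polynomial_def hd_map hd_rev last_coeffs_eq_coeff_degree)

lemma closure_algebraic: "(closure.algebraic over base_field) (x :: 'k::field alg_closure)"
proof -
  obtain p :: "'k poly" where p: "p \<noteq> 0" "poly (map_poly to_ac p) x = 0"
    by (rule alg_closure_algebraic)
  then have "closure.eval (map to_ac (rev (coeffs p))) x = 0"
    by (simp add: eval_ac_def flip: eval_ac_eq_closure_eval)
  then show ?thesis
    using closure.algebraicI[OF poly_list_carrier[OF p(1)]] p(1) by simp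
qed

text \<open>As \<open>x\<close> is algebraic, the ring generated by \<open>x\<close> over the base
  field is already a field. Dimensions of simple extensions thus become degrees of minimal
  polynomials.\<close>

lemma adjoin_eq_simple_extension: "adjoin x = closure.simple_extension base_field x"
proof -
  note K = base_field_subfield
  have sub: "subfield (closure.simple_extension base_field x) closure_ring"
    by (rule closure.simple_extension_is_subfield[THEN iffD2, OF K _ closure_algebraic]) simp
  show ?thesis
    unfolding adjoin_def
  proof (rule field.generate_fieldI[OF field_from_type_algebra, symmetric, OF _ sub])
    show "insert x base_field \<subseteq> closure.simple_extension base_field x"
      using closure.simple_extension_incl[of base_field x]
        closure.simple_extension_mem[OF subfieldE(1)[OF K], of x] by auto
    show "closure.simple_extension base_field x \<subseteq> K'"
      if "subfield K' closure_ring" "insert x base_field \<subseteq> K'" for K'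
      using closure.simple_extension_subring_incl[OF subfieldE(1)[OF that(1)]] that(2) by auto
  qed simp
qed

lemma degK_eq_degree_Irr:
  "degK x = Polynomials.degree (closure.Irr base_field x)"
  using closure.simple_extension_dim[OF base_field_subfield _ closure_algebraic, of x]
  by (simp add: degK_def ext_degree_def adjoin_eq_simple_extension over_def)

lemma degK_le:
  assumes "p \<noteq> 0" "eval_ac p x = 0"
  shows "degK x \<le> Polynomial.degree p"
proof -
  note K = base_field_subfield
  let ?P = "map to_ac (rev (coeffs p))"
  have P: "?P \<in> carrier (base_field[X]\<^bsub>closure_ring\<^esub>)"
    by (rule poly_list_carrier[OF assms(1)])
  have "closure.Irr base_field x pdivides\<^bsub>closure_ring\<^esub> ?P"
    by (rule closure.Irr_minimal[OF K _ closure_algebraic P])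
      (use assms in \<open>simp_all flip: eval_ac_eq_closure_eval\<close>)
  then have "Polynomials.degree (closure.Irr base_field x) \<le> Polynomials.degree ?P"
    using closure.pdivides_imp_degree_le[OF subfieldE(1)[OF K] closure.IrrE(1)[OF K _ closure_algebraic] P]
      assms(1) by simp
  then show ?thesis by (simp add: degK_eq_degree_Irr degree_eq_length_coeffs)
qed

lemma min_poly_exists:
  "\<exists>p. Polynomial.lead_coeff p = 1 \<and> Polynomial.degree p = degK x \<and> 0 < degK x \<and> eval_ac p x = 0"
proof -
  note K = base_field_subfield
  let ?I = "closure.Irr base_field x"
  note I = closure.IrrE[OF K _ closure_algebraic, of x, simplified]
  have set: "set ?I \<subseteq> base_field" and ne: "?I \<noteq> []"
    using I(1,3) closure.pirreducible_degree[OF K I(1,2)]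
    by (auto simp: univ_poly_def polynomial_def)
  define xs where "xs = map of_ac ?I"
  have xs: "map to_ac xs = ?I" unfolding xs_def map_map
    by (rule map_idI) (use set to_ac_of_ac in auto)
  define p where "p = Poly (rev xs)"
  have hd: "hd xs = 1" using I(3) ne xs by (metis hd_map list.map_disc_iff to_ac_eq_1_iff)
  have ne': "xs \<noteq> []" using ne xs by auto
  \<comment> \<open>The leading coefficient \<open>1\<close> ends the reversed list, so
    \<open>Poly\<close> strips nothing and the degree can be read off the length.\<close>
  have "no_trailing (HOL.eq 0) (rev xs)"
    using hd ne' by (cases xs) (auto simp: no_trailing_unfold)
  then have cf: "coeffs p = rev xs" unfolding p_def coeffs_Poly by (subst strip_while_idem_iff)
  have dg: "Polynomial.degree p = length ?I - 1"
    unfolding degree_eq_length_coeffs cf by (simp flip: xs)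
  have "p \<noteq> 0" using cf ne' by auto
  then have "Polynomial.lead_coeff p = 1"
    using last_coeffs_eq_coeff_degree[of p] hd ne' by (simp add: cf last_rev)
  moreover have "eval_ac p x = 0" using I(4) by (simp add: p_def eval_ac_Poly xs)
  moreover have "0 < degK x"
    using closure.pirreducible_degree[OF K I(1,2)] by (simp add: degK_eq_degree_Irr)
  ultimately show ?thesis using dg degK_eq_degree_Irr[of x] by metis
qed

lemma degK_pos: "0 < degK x"
  using min_poly_exists by blast

lemma eval_ac_nonzero: "p \<noteq> 0 \<Longrightarrow> Polynomial.degree p < degK x \<Longrightarrow> eval_ac p x \<noteq> 0"
  using degK_le[of p x] by auto

lemma dvd_of_root:
  assumes "eval_ac p x = 0" "Polynomial.degree p = degK x" "eval_ac f x = 0"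
  shows "p dvd f"
proof -
  have p0: "p \<noteq> 0" using assms(2) degK_pos[of x] by auto
  have "eval_ac (f mod p) x = 0"
    using assms(1,3) by (simp add: minus_div_mult_eq_mod[symmetric])
  moreover have "f mod p = 0 \<or> Polynomial.degree (f mod p) < degK x"
    using degree_mod_less[OF p0, of f] assms(2) by auto
  ultimately have "f mod p = 0" using eval_ac_nonzero by blast
  then show ?thesis by auto
qed

text \<open>A polynomial of least degree vanishing at \<open>x\<close> is irreducible, since one of
  its factors vanishes at \<open>x\<close> and already has full degree. It divides every competitor,
  and two monic associated polynomials coincide.\<close>

lemma min_polyK_unique: "\<exists>!p. Polynomial.lead_coeff p = 1 \<and> Factorial_Ring.irreducible p \<and> eval_ac p x = 0"
  and min_polyK_degree_aux: "\<exists>p. Polynomial.lead_coeff p = 1 \<and> Factorial_Ring.irreducible p \<and>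
    eval_ac p x = 0 \<and> Polynomial.degree p = degK x"
proof -
  obtain p where p: "Polynomial.lead_coeff p = 1" "Polynomial.degree p = degK x" "eval_ac p x = 0"
    using min_poly_exists by blast
  have p0: "p \<noteq> 0" using p(1) by auto
  have irr: "Factorial_Ring.irreducible p"
  proof (rule Factorial_Ring.irreducibleI[OF p0])
    show "\<not> is_unit p" using degK_pos[of x] p(2) is_unit_iff_degree[OF p0] by simp
    fix a b assume ab: "p = a * b"
    have nz: "a \<noteq> 0" "b \<noteq> 0" using ab p0 by auto
    have deg: "Polynomial.degree a + Polynomial.degree b = degK x"
      using p(2) ab degree_mult_eq[OF nz] by simp
    have "eval_ac a x = 0 \<or> eval_ac b x = 0" using p(3) ab by simp
    then show "is_unit a \<or> is_unit b"
      using deg degK_le[OF nz(1), of x] degK_le[OF nz(2), of x]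
      unfolding is_unit_iff_degree[OF nz(1)] is_unit_iff_degree[OF nz(2)] by linarith
  qed
  have uniq: "q = p" if q: "Polynomial.lead_coeff q = 1" "Factorial_Ring.irreducible q" "eval_ac q x = 0" for q
  proof -
    have "p dvd q" using dvd_of_root p q by blast
    then obtain r where r: "q = p * r" by (elim dvdE)
    then have "is_unit r" using q(2) irr Factorial_Ring.irreducibleD[of q p r] 
      by (auto simp: Factorial_Ring.irreducible_def)
    then obtain c where c: "r = [:c:]" by (metis is_unit_poly_iff)
    have "q = smult c p" using r c by simp
    moreover from this have "c = 1" using q(1) p(1) by (cases "c = 0") auto
    ultimately show ?thesis by simp
  qed
  show "\<exists>!p. Polynomial.lead_coeff p = 1 \<and> Factorial_Ring.irreducible p \<and> eval_ac p x = 0"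
    using p irr uniq by blast
  show "\<exists>p. Polynomial.lead_coeff p = 1 \<and> Factorial_Ring.irreducible p \<and>
    eval_ac p x = 0 \<and> Polynomial.degree p = degK x"
    using p irr by blast
qed

lemma min_polyK:
  shows min_polyK_monic: "Polynomial.lead_coeff (min_polyK x) = 1"
    and min_polyK_root: "eval_ac (min_polyK x) x = 0"
    and degree_min_polyK: "Polynomial.degree (min_polyK x) = degK x"
  using theI'[OF min_polyK_unique[of x]] min_polyK_degree_aux[of x] min_polyK_unique[of x]
  unfolding min_polyK_def by (auto dest: the1_equality)

section \<open>Residues and ramification of tame elements\<close>

text \<open>
  Translation by \<open>g\<close> permutes the cosets, so summing \<open>g + r Y - r (g +o Y) \<in> H\<close> over all cosets \<open>Y\<close>,
  with \<open>r\<close> choosing representatives, leaves only copies of \<open>g\<close>.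
\<close>

lemma index_multiple_mem:
  fixes G H :: "'g::ab_group_add set"
  assumes H: "0 \<in> H" "\<And>a b. a \<in> H \<Longrightarrow> b \<in> H \<Longrightarrow> a + b \<in> H" "\<And>a. a \<in> H \<Longrightarrow> - a \<in> H"
    and G: "\<And>a b. a \<in> G \<Longrightarrow> b \<in> G \<Longrightarrow> a + b \<in> G" "\<And>a. a \<in> G \<Longrightarrow> - a \<in> G"
    and fin: "finite ((\<lambda>\<gamma>. \<gamma> +o H) ` G)" and g: "g \<in> G"
  shows "(\<Sum>j<card ((\<lambda>\<gamma>. \<gamma> +o H) ` G). g) \<in> H"
proof -
  define C where "C = (\<lambda>\<gamma>. \<gamma> +o H) ` G"
  define r where "r Y = (SOME a. a \<in> G \<and> Y = a +o H)" for Y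
  have r: "r Y \<in> G \<and> Y = r Y +o H" if "Y \<in> C" for Y
  proof -
    have "\<exists>a. a \<in> G \<and> Y = a +o H" using that by (auto simp: C_def)
    then show ?thesis unfolding r_def by (rule someI_ex)
  qed
  have coset: "a +o H = b +o H \<longleftrightarrow> a - b \<in> H" for a b
  proof
    assume "a +o H = b +o H"
    then have "a \<in> b +o H" using H(1) by (metis add.right_neutral set_plus_intro2)
    then show "a - b \<in> H" by (auto simp: elt_set_plus_def)
  next
    assume ab: "a - b \<in> H"
    have "x \<in> b +o H \<longleftrightarrow> x - b \<in> H" for x b by (force simp: elt_set_plus_def)
    moreover have "x - a \<in> H \<longleftrightarrow> x - b \<in> H" for x
      using H(2)[OF ab, of "x - a"] H(2)[OF H(3)[OF ab], of "x - b"] by (auto simp: algebra_simps)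
    ultimately show "a +o H = b +o H" by blast
  qed
  have plus: "g +o (a +o H) = (g + a) +o H" for a by (rule set_plus_rearrange2)
  have inj: "inj_on ((+o) g) C"
    by (rule inj_onI) (metis set_plus_rearrange2 add.left_inverse set_zero_plus)
  have sub: "(+o) g ` C \<subseteq> C" using G(1) g plus by (auto simp: C_def)
  have "finite C" using fin by (simp add: C_def)
  then have img: "(+o) g ` C = C" by (rule endo_inj_surj) (use inj sub in auto)
  have "(\<Sum>Y\<in>C. r Y) = (\<Sum>Y\<in>C. r (g +o Y))"
    using sum.reindex[OF inj, of r] img by simp
  then have "(\<Sum>Y\<in>C. g) = (\<Sum>Y\<in>C. g + r Y - r (g +o Y))"
    by (simp add: sum.distrib sum_subtractf)
  also have "\<dots> \<in> H"
  proof -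
    have "g + r Y - r (g +o Y) \<in> H" if Y: "Y \<in> C" for Y
    proof -
      have "g +o Y \<in> C" using sub Y by auto
      then have "r (g +o Y) +o H = (g + r Y) +o H" using r[OF Y] r[of "g +o Y"] plus by metis
      then show ?thesis using coset by metis
    qed
    note * = this
    have "(\<Sum>Y\<in>S. g + r Y - r (g +o Y)) \<in> H" if "finite S" "S \<subseteq> C" for S
      using that
    proof (induction S rule: finite_induct)
      case (insert Y S)
      then show ?case using H(2)[OF *[of Y]] by simp
    qed (simp add: H)
    then show ?thesis using \<open>finite C\<close> by blast
  qed
  finally have "(\<Sum>Y\<in>C. g) \<in> H" .
  moreover obtain b where "bij_betw b {0..<card C} C"
    using ex_bij_betw_nat_finite[OF \<open>finite C\<close>] by blast
  then have "(\<Sum>j<card C. g) = (\<Sum>Y\<in>C. g)"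
    using sum.reindex_bij_betw[of b "{0..<card C}" C "\<lambda>_. g"] by (simp only: atLeast0LessThan)
  ultimately show ?thesis by (simp only: C_def)
qed

lemma adjoin_subfield: "subfield (adjoin x) closure_ring"
  unfolding adjoin_def by (rule field.generate_field_is_subfield[OF field_from_type_algebra]) simp

lemma base_field_subset_adjoin: "base_field \<subseteq> adjoin x"
  unfolding adjoin_def by (auto intro: generate_field.incl)

lemma eval_ac_mem_adjoin: "eval_ac p x \<in> adjoin x"
proof -
  note S = subfieldE(1)[OF adjoin_subfield[of x]]
  have x: "x \<in> adjoin x" unfolding adjoin_def by (auto intro: generate_field.incl)
  show ?thesis
  proof (induction p)
    case 0
    then show ?case using subringE(2)[OF S] by simp
  next
    case (pCons a p)
    have "to_ac a + x * eval_ac p x \<in> adjoin x"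
      using subringE(7)[OF S, of "to_ac a" "x * eval_ac p x"] subringE(6)[OF S x pCons(2)]
        base_field_subset_adjoin[of x] by auto
    then show ?case by (simp add: eval_ac_def)
  qed
qed

section \<open>Value groups and residue fields inside the algebraic closure\<close>

locale closure_valuation = closed_valued_field v
  for v :: "'k::field alg_closure \<Rightarrow> 'g::linordered_ab_group_add extended"
begin

lemma value_group_subfield:
  assumes "subfield L closure_ring"
  shows "0 \<in> value_group v L"
    and "a \<in> value_group v L \<Longrightarrow> b \<in> value_group v L \<Longrightarrow> a + b \<in> value_group v L"
    and "a \<in> value_group v L \<Longrightarrow> - a \<in> value_group v L"
proof -
  note S = subfieldE(1)[OF assms]
  show "0 \<in> value_group v L"
    using subringE(3)[OF S] unfolding value_group_def
    by (auto intro!: bexI[of _ 1] simp: zero_extended_def)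
  show "a + b \<in> value_group v L" if "a \<in> value_group v L" "b \<in> value_group v L"
  proof -
    obtain x y where "x \<in> L - {0}" "v x = Fin a" "y \<in> L - {0}" "v y = Fin b"
      using \<open>a \<in> value_group v L\<close> \<open>b \<in> value_group v L\<close> unfolding value_group_def by blast
    then show ?thesis
      using subringE(6)[OF S, of x y] unfolding value_group_def
      by (auto intro!: bexI[of _ "x * y"] simp: v_mult)
  qed
  show "- a \<in> value_group v L" if "a \<in> value_group v L"
  proof -
    obtain x where x: "x \<in> L" "x \<noteq> 0" "v x = Fin a"
      using \<open>a \<in> value_group v L\<close> unfolding value_group_def by blast
    have "inverse x \<in> L"
      using closure.subfield_m_inv(1)[OF assms, of x] x by simp
    then show ?thesis
      using x unfolding value_group_def
      by (auto intro!: bexI[of _ "inverse x"] simp: v_inverse)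
  qed
qed

abbreviation vring :: "'k alg_closure ring" where "vring \<equiv> valuation_ring v"
abbreviation kbar :: "'k alg_closure set ring" where "kbar \<equiv> residue_closure v"
abbreviation res :: "'k alg_closure \<Rightarrow> 'k alg_closure set" where
  "res x \<equiv> valuation_ideal v +>\<^bsub>vring\<^esub> x"

lemma valuation_ring_simps [simp]:
  "carrier vring = {x. 0 \<le> v x}" "x \<otimes>\<^bsub>vring\<^esub> y = x * y" "x \<oplus>\<^bsub>vring\<^esub> y = x + y"
  "\<one>\<^bsub>vring\<^esub> = 1" "\<zero>\<^bsub>vring\<^esub> = 0"
  by (simp_all add: valuation_ring_def ring_of_type_algebra_def)

lemma domain_valuation_ring: "domain vring"
  unfolding valuation_ring_def
  by (rule closure.subring_is_domain, rule closure.subringI) (auto intro: le_add integral_mult)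

lemma mult_pos: "0 < v a \<Longrightarrow> 0 \<le> v x \<Longrightarrow> 0 < v (x * a)"
  using mult_less_le_mono[of 1 a 1 x] by (simp add: mult.commute)

lemma pos_mult: "0 < v a \<Longrightarrow> 0 \<le> v x \<Longrightarrow> 0 < v (a * x)"
  using mult_pos[of a x] by (simp add: mult.commute)

text \<open>An integral element outside the ideal has value \<open>0\<close>, so its inverse is
  integral and a larger ideal contains \<open>1\<close>.\<close>

lemma maximalideal_valuation_ideal: "maximalideal (valuation_ideal v) vring"
proof -
  interpret V: domain vring by (rule domain_valuation_ring)
  have uminus: "\<ominus>\<^bsub>vring\<^esub> x = - x" if "0 \<le> v x" for x
    using that by (intro V.minus_equality) auto
  have "subgroup (valuation_ideal v) (add_monoid vring)"
  proof (rule V.add.subgroupI)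
    show "\<ominus>\<^bsub>vring\<^esub> a \<in> valuation_ideal v" if "a \<in> valuation_ideal v" for a
      using that uminus[of a] by (simp add: valuation_ideal_def)
  qed (auto simp: valuation_ideal_def zero_extended_def intro: less_add exI[of _ 0])
  then have I: "ideal (valuation_ideal v) vring"
    by (rule idealI[OF V.ring_axioms])
      (auto simp: valuation_ideal_def mult_pos pos_mult)
  show ?thesis
  proof (rule maximalidealI[OF I])
    show "carrier vring \<noteq> valuation_ideal v"
    proof
      assume "carrier vring = valuation_ideal v"
      then have "1 \<in> valuation_ideal v" by (metis V.one_closed valuation_ring_simps(4))
      then show False by (simp add: valuation_ideal_def)
    qed
    fix J assume J: "ideal J vring" "valuation_ideal v \<subseteq> J" "J \<subseteq> carrier vring"
    show "J = valuation_ideal v \<or> J = carrier vring"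
    proof (cases "J \<subseteq> valuation_ideal v")
      case False
      then obtain x where x: "x \<in> J" "\<not> 0 < v x" by (auto simp: valuation_ideal_def)
      then have vx: "v x = 0" using J(3) by force
      then have "x \<noteq> 0" by (auto simp: zero_extended_def)
      moreover from this have "v (inverse x) = 0" by (simp add: v_inverse vx zero_extended_def)
      ultimately have "1 \<in> J"
        using ideal.I_l_closed[OF J(1) x(1), of "inverse x"] by simp
      then show ?thesis using ideal.one_imp_carrier[OF J(1)] by simp
    qed (use J(2) in blast)
  qed
qed

lemma field_residue_closure: "field kbar"
  unfolding residue_closure_def
  using maximalideal.quotient_is_field[OF maximalideal_valuation_ideal]
    domain.axioms(1)[OF domain_valuation_ring] by blast

lemma res_eq_iff: "0 \<le> v x \<Longrightarrow> 0 \<le> v y \<Longrightarrow> res x = res y \<longleftrightarrow> 0 < v (x - y)"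
proof -
  have *: "z \<in> res x \<longleftrightarrow> 0 < v (z - x)" for x z
    by (force simp: a_r_coset_def r_coset_def valuation_ideal_def)
  have "0 < v (x - y) \<Longrightarrow> res x = res y"
    using less_add[of 0 _ "x - y"] less_diff[of 0 _ "x - y"] by (fastforce simp: set_eq_iff *)
  moreover have "res x = res y \<Longrightarrow> 0 < v (x - y)"
    using *[of x x] *[of x y] by (auto simp: zero_extended_def)
  ultimately show "res x = res y \<longleftrightarrow> 0 < v (x - y)" by blast
qed

lemma res_hom: "res \<in> ring_hom vring kbar"
  unfolding residue_closure_def
  by (rule ideal.rcos_ring_hom[OF maximalideal.axioms(1)[OF maximalideal_valuation_ideal]])

lemma res_carrier: "0 \<le> v x \<Longrightarrow> res x \<in> carrier kbar"
  using ring_hom_memE(1)[OF res_hom] by simp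

lemma res_simps:
  assumes "0 \<le> v x" "0 \<le> v y"
  shows "res x \<otimes>\<^bsub>kbar\<^esub> res y = res (x * y)"
    "res x \<oplus>\<^bsub>kbar\<^esub> res y = res (x + y)"
  using ring_hom_memE[OF res_hom] assms by auto

lemma res_one: "\<one>\<^bsub>kbar\<^esub> = res 1"
  using ring_hom_memE(4)[OF res_hom] by simp

lemma res_zero: "\<zero>\<^bsub>kbar\<^esub> = res 0"
  using ring_hom_zero[OF res_hom] domain_valuation_ring field_residue_closure
  by (metis cring.axioms(1) domain.axioms(1) field.axioms(1) valuation_ring_simps(5))

lemma res_eq_zero_iff: "0 \<le> v x \<Longrightarrow> res x = \<zero>\<^bsub>kbar\<^esub> \<longleftrightarrow> 0 < v x"
  using res_eq_iff[of x 0] by (simp add: res_zero)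

interpretation residue: domain kbar
  by (rule field.axioms(1)[OF field_residue_closure])

lemma res_minus: "0 \<le> v x \<Longrightarrow> \<ominus>\<^bsub>kbar\<^esub> res x = res (- x)"
  using res_simps[of "- x" x] res_carrier[of x] res_carrier[of "- x"]
  by (intro residue.minus_equality) (auto simp: res_zero)

text \<open>A natural number of positive value is zero in the residue field and hence a multiple of
  the residue characteristic.\<close>

lemma of_nat_unit:
  assumes "residue_char v = 0 \<or> \<not> residue_char v dvd e" "e \<noteq> 0"
  shows "v (of_nat e) = 0"
proof (rule ccontr)
  assume "v (of_nat e) \<noteq> 0"
  then have pos: "0 < v (of_nat e)" using integral_of_nat[of e] by auto
  have "add_pow kbar n \<one>\<^bsub>kbar\<^esub> = res (of_nat n)" for n :: nat
  proof (induction n)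
    case (Suc n)
    then show ?case
      using res_simps(2)[of "of_nat n" 1] integral_of_nat[of n]
      by (simp add: res_one residue.add.nat_pow_Suc add.commute)
  qed (simp add: res_zero)
  then have mem: "e \<in> {n. add_pow kbar n \<one>\<^bsub>kbar\<^esub> = \<zero>\<^bsub>kbar\<^esub>}"
    using res_eq_zero_iff[of "of_nat e"] integral_of_nat[of e] pos by simp
  then have "residue_char v dvd e"
    unfolding residue_char_def by (rule Gcd_dvd)
  \<comment> \<open>In residue characteristic \<open>0\<close> this divisibility means
    \<open>e = 0\<close>.\<close>
  then show False using assms by simp
qed

lemma residue_subfield:
  assumes "subfield L closure_ring"
  shows "subfield (residue_field v L) kbar"
proof (rule field.subfieldI'[OF field_residue_closure])
  note S = subringE[OF subfieldE(1)[OF assms]]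
  show "subring (residue_field v L) kbar"
  proof (rule residue.subringI)
    show "\<one>\<^bsub>kbar\<^esub> \<in> residue_field v L"
      using S(3) by (auto simp: residue_field_def res_one)
    show "residue_field v L \<subseteq> carrier kbar"
      by (auto simp: residue_field_def res_carrier)
    show "\<ominus>\<^bsub>kbar\<^esub> h \<in> residue_field v L" if "h \<in> residue_field v L" for h
      using that S(5) by (auto simp: residue_field_def res_minus)
    fix h1 h2 assume "h1 \<in> residue_field v L" "h2 \<in> residue_field v L"
    then obtain x y where "h1 = res x" "x \<in> L" "0 \<le> v x" "h2 = res y" "y \<in> L" "0 \<le> v y"
      by (auto simp: residue_field_def)
    then show "h1 \<oplus>\<^bsub>kbar\<^esub> h2 \<in> residue_field v L" "h1 \<otimes>\<^bsub>kbar\<^esub> h2 \<in> residue_field v L"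
      using S(6,7)[of x y] by (auto simp: residue_field_def res_simps intro: le_add integral_mult)
  qed
  fix h assume "h \<in> residue_field v L - {\<zero>\<^bsub>kbar\<^esub>}"
  then obtain x where x: "h = res x" "x \<in> L" "0 \<le> v x" "\<not> 0 < v x"
    using res_eq_zero_iff unfolding residue_field_def by blast
  then have vx: "v x = 0" by simp
  then have x0: "x \<noteq> 0" by (auto simp: zero_extended_def)
  then have vi: "v (inverse x) = 0" by (simp add: v_inverse vx zero_extended_def)
  have "inv\<^bsub>kbar\<^esub> h = res (inverse x)"
    using vx vi x0 x(1) res_simps[of x "inverse x"] res_simps[of "inverse x" x] res_carrier[of x] res_carrier[of "inverse x"]
    by (intro residue.inv_char) (auto simp: res_one)
  then show "inv\<^bsub>kbar\<^esub> h \<in> residue_field v L"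
    using closure.subfield_m_inv(1)[OF assms, of x] x(2) x0 vi by (auto simp: residue_field_def)
qed

lemma res_eval:
  assumes "\<forall>y\<in>set ys. 0 \<le> v y" "0 \<le> v u"
  shows "residue.eval (map res ys) (res u) = res (closure.eval ys u)"
proof -
  have pow: "res u [^]\<^bsub>kbar\<^esub> (n::nat) = res (u ^ n)" for n
    by (induction n) (use assms in \<open>auto simp: res_one res_simps integral_power mult.commute\<close>)
  have int: "0 \<le> v (closure.eval ys u)" if "\<forall>y\<in>set ys. 0 \<le> v y" for ys
    using that by (induction ys) (auto intro!: le_add integral_mult integral_power assms(2))
  show ?thesis using assms(1)
  proof (induction ys)
    case (Cons y ys)
    then show ?case
      using int[of ys] assms(2) by (simp add: pow res_simps integral_power integral_mult)
  qed (simp add: res_zero)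
qed

lemma res_coeff:
  assumes "\<forall>x\<in>set xs. 0 \<le> v x"
  shows "residue.coeff (map res (rev xs)) i = res (nth_default 0 xs i)"
proof (cases "i < length xs")
  case True
  then have "residue.coeff (map res (rev xs)) i = map res (rev xs) ! (length xs - 1 - i)"
    using residue.coeff_nth[of i "map res (rev xs)"] by simp
  then show ?thesis using True by (simp add: rev_nth nth_default_nth)
next
  case False
  then show ?thesis using residue.coeff_length[of "map res (rev xs)" i]
    by (simp add: nth_default_beyond res_zero)
qed

section \<open>Reduction of integral polynomials and lifting of separable residues\<close>

lemma set_coeffs_memE:
  assumes "x \<in> set (coeffs f)"
  obtains i where "x = poly.coeff f i"
  using assms range_coeff[of f] by (metis insertCI rangeE)

text \<open>Leading coefficients may reduce to zero; \<open>normalize\<close> removes them so that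
  the list represents a polynomial.\<close>

definition reduction :: "'k alg_closure poly \<Rightarrow> 'k alg_closure set list" where
  "reduction f = residue.normalize (map res (rev (coeffs f)))"

lemma reduction_carrier:
  assumes "\<And>i. poly.coeff f i \<in> L" "\<And>i. 0 \<le> v (poly.coeff f i)"
  shows "reduction f \<in> carrier ((residue_field v L)[X]\<^bsub>kbar\<^esub>)"
proof -
  have "set (map res (rev (coeffs f))) \<subseteq> residue_field v L"
    using assms by (auto simp: residue_field_def elim!: set_coeffs_memE)
  then show ?thesis unfolding reduction_def univ_poly_carrier[symmetric]
    by (rule residue.normalize_gives_polynomial)
qed

lemma residue_field_UNIV: "residue_field v UNIV = carrier kbar"
  by (auto simp: residue_field_def residue_closure_def FactRing_def A_RCOSETS_def RCOSETS_def
      a_r_coset_def)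

lemma integral_coeffs:
  "(\<And>i. 0 \<le> v (poly.coeff f i)) \<Longrightarrow> \<forall>x\<in>set (rev (coeffs f)). 0 \<le> v x"
  by (auto elim: set_coeffs_memE)

lemma reduction_coeff:
  assumes "\<And>i. 0 \<le> v (poly.coeff f i)"
  shows "residue.coeff (reduction f) i = res (poly.coeff f i)"
  using res_coeff[of "coeffs f" i] integral_coeffs[OF assms]
  by (simp add: reduction_def nth_default_coeffs_eq flip: residue.normalize_coeff)

lemma reduction_eval:
  assumes "\<And>i. 0 \<le> v (poly.coeff f i)" "0 \<le> v u"
  shows "residue.eval (reduction f) (res u) = res (poly f u)"
proof -
  have "residue.eval (reduction f) (res u) = residue.eval (map res (rev (coeffs f))) (res u)"
    unfolding reduction_def
    by (rule residue.eval_normalize) (use integral_coeffs[OF assms(1)] assms(2) res_carrier in auto)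
  also have "\<dots> = res (poly f u)"
    using res_eval[of "rev (coeffs f)" u] integral_coeffs[OF assms(1)] assms(2) by (simp add: closure_eval)
  finally show ?thesis .
qed

text \<open>Coefficients are compared in the residue field, so a congruence of \<open>h\<close> with
  \<open>f * g\<close> modulo the maximal ideal suffices.\<close>

lemma reduction_mult:
  assumes f: "\<And>i. 0 \<le> v (poly.coeff f i)" and g: "\<And>i. 0 \<le> v (poly.coeff g i)"
    and h: "\<And>i. 0 \<le> v (poly.coeff h i)" and cong: "\<And>i. 0 < v (poly.coeff h i - poly.coeff (f * g) i)"
  shows "reduction h = reduction f \<otimes>\<^bsub>poly_ring kbar\<^esub> reduction g"
proof -
  have c: "reduction p \<in> carrier (poly_ring kbar)" if "\<And>i. 0 \<le> v (poly.coeff p i)" for p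
    using reduction_carrier[of p UNIV] that by (simp add: residue_field_UNIV)
  note cf = c[OF f] and cg = c[OF g] and ch = c[OF h]
  have sets: "set (reduction f) \<subseteq> carrier kbar" "set (reduction g) \<subseteq> carrier kbar"
    using cf cg residue.polynomial_incl by (auto simp flip: univ_poly_carrier)
  have fs: "finsum kbar (\<lambda>k. res (a k)) {..n} = res (\<Sum>k\<le>n. a k) \<and> 0 \<le> v (\<Sum>k\<le>n. a k)"
    if "\<And>k. 0 \<le> v (a k)" for a and n :: nat
  proof (induction n)
    case 0
    have "finsum kbar (\<lambda>k. res (a k)) {..0} = res (a 0)"
      using residue.add.finprod_singleton[of 0 "{0::nat}" "\<lambda>k. res (a k)"] res_carrier that
      by (subst residue.finsum_0) auto
    then show ?case using that by simp
  next
    case (Suc n)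
    then show ?case using that
      by (subst residue.finsum_Suc) (auto simp: res_simps res_carrier add.commute intro: le_add)
  qed
  have "residue.coeff (reduction h) i = residue.coeff (residue.poly_mult (reduction f) (reduction g)) i" for i
  proof -
    have "residue.coeff (residue.poly_mult (reduction f) (reduction g)) i =
        finsum kbar (\<lambda>k. res (poly.coeff f k * poly.coeff g (i - k))) {..i}"
      unfolding residue.poly_mult_coeff[OF sets]
      by (simp add: reduction_coeff f g res_simps)
    also have "\<dots> = res (poly.coeff (f * g) i)"
      unfolding coeff_mult using fs[of "\<lambda>k. poly.coeff f k * poly.coeff g (i - k)" i]
      by (simp add: f g integral_mult)
    also have "\<dots> = res (poly.coeff h i)"
      using fs[of "\<lambda>k. poly.coeff f k * poly.coeff g (i - k)" i] cong[of i] h[of i]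
      by (subst res_eq_iff) (auto simp: f g integral_mult coeff_mult v_diff_commute)
    finally show ?thesis by (simp add: reduction_coeff h)
  qed
  then have "reduction h = residue.poly_mult (reduction f) (reduction g)"
    using ch cf cg residue.poly_mult_closed[OF residue.carrier_is_subring]
    by (subst residue.coeff_iff_polynomial_cond[of "carrier kbar"]) (auto simp flip: univ_poly_carrier)
  then show ?thesis by (simp add: univ_poly_mult)
qed

text \<open>Dividing an annihilating polynomial by a coefficient of least value makes it integral
  with one coefficient equal to \<open>1\<close>, so its reduction is nonzero and annihilates the
  residue.\<close>

lemma residue_algebraic:
  assumes "0 \<le> v u"
  shows "(residue.algebraic over residue_field v base_field) (res u)"
proof -
  obtain p :: "'k poly" where p: "p \<noteq> 0" "poly (map_poly to_ac p) u = 0"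
    by (rule alg_closure_algebraic)
  define N where "N = {i. i \<le> Polynomial.degree p}"
  have "finite N" "N \<noteq> {}" by (auto simp: N_def)
  then obtain j where j: "j \<in> N" "\<And>i. i \<in> N \<Longrightarrow> v (to_ac (poly.coeff p j)) \<le> v (to_ac (poly.coeff p i))"
    using ex_min_if_finite[of "(\<lambda>i. v (to_ac (poly.coeff p i))) ` N"] by (force simp: not_less)
  have le: "v (to_ac (poly.coeff p j)) \<le> v (to_ac (poly.coeff p i))" for i
    using j(2)[of i] by (cases "i \<in> N") (auto simp: N_def coeff_eq_0)
  have pj: "poly.coeff p j \<noteq> 0"
    using le[of "Polynomial.degree p"] p(1) by auto
  define f where "f = map_poly to_ac (smult (inverse (poly.coeff p j)) p)"
  have fi: "0 \<le> v (poly.coeff f i)" for i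
  proof -
    have "to_ac (poly.coeff p j) * poly.coeff f i = to_ac (poly.coeff p i)"
      using pj by (simp add: f_def coeff_map_poly)
    then show ?thesis
      using le[of i] mult_le_cancel[of "to_ac (poly.coeff p j)" 1 "poly.coeff f i"] pj by simp
  qed
  have fK: "poly.coeff f i \<in> base_field" for i
    by (auto simp: f_def coeff_map_poly simp flip: to_ac_mult to_ac_inverse)
  have fj: "poly.coeff f j = 1" using pj by (simp add: f_def coeff_map_poly)
  have "residue.coeff (reduction f) j = \<one>\<^bsub>kbar\<^esub>"
    by (simp add: reduction_coeff fi fj res_one)
  then have "reduction f \<noteq> []" by auto
  moreover have "residue.eval (reduction f) (res u) = \<zero>\<^bsub>kbar\<^esub>"
    using p(2) by (simp add: reduction_eval fi assms) (simp add: f_def res_zero)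
  ultimately show ?thesis
    using residue.algebraicI[OF reduction_carrier[of f base_field]] fi fK by blast
qed

text \<open>Horner's scheme only adds and multiplies the coefficients and \<open>u\<close>.\<close>

lemma integral_synthetic_div:
  assumes "\<And>i. 0 \<le> v (poly.coeff p i)" "0 \<le> v u"
  shows "0 \<le> v (poly.coeff (synthetic_div p u) i)"
  using assms(1)
proof (induction p arbitrary: i)
  case (pCons a p)
  have *: "0 \<le> v (poly.coeff p i)" for i using pCons(3)[of "Suc i"] by simp
  show ?case
    using pCons(2)[OF *] integral_poly[OF * assms(2)] by (cases i) simp_all
qed simp

text \<open>\<open>h\<close> lifts the minimal polynomial of the residue of \<open>u\<close>
  coefficient by coefficient. By separability that residue is a simple root, so the derivative of
  \<open>h\<close> at \<open>u\<close> is a unit.\<close>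

lemma residue_separable_lift:
  assumes L: "residue_separable v L" "u \<in> L" and u: "0 \<le> v u"
  obtains h where "\<And>i. 0 \<le> v (to_ac (poly.coeff h i))" "0 < v (eval_ac h u)"
    "v (divided_diff (map_poly to_ac h) u u) = 0"
proof -
  let ?k = "residue_field v base_field"
  let ?I = "residue.Irr ?k (res u)"
  have k: "subfield ?k kbar" by (rule residue_subfield[OF base_field_subfield])
  note alg = residue_algebraic[OF u]
  have ru: "res u \<in> carrier kbar" using res_carrier u by blast
  note Irr = residue.IrrE[OF k ru alg]
  have ne: "?I \<noteq> []" using residue.pirreducible_degree[OF k Irr(1,2)] by auto
  have mult: "residue.alg_mult ?I (res u) \<le> 1"
    using L u ru by (auto simp: residue_separable_def residue_field_def)
  have "set ?I \<subseteq> ?k" using Irr(1) residue.polynomial_incl by (simp flip: univ_poly_carrier)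
  then have "\<forall>\<zeta>\<in>set ?I. \<exists>a. \<zeta> = res (to_ac a) \<and> 0 \<le> v (to_ac a)" by (auto simp: residue_field_def)
  then obtain lift where lift: "\<And>\<zeta>. \<zeta> \<in> set ?I \<Longrightarrow> \<zeta> = res (to_ac (lift \<zeta>)) \<and> 0 \<le> v (to_ac (lift \<zeta>))"
    by metis
  define ys where "ys = map lift ?I"
  have ys: "map res (map to_ac ys) = ?I" "\<forall>y\<in>set (map to_ac ys). 0 \<le> v y"
  proof -
    show "map res (map to_ac ys) = ?I"
      unfolding ys_def map_map comp_def by (rule map_idI) (use lift in metis)
    show "\<forall>y\<in>set (map to_ac ys). 0 \<le> v y" unfolding ys_def using lift by auto
  qed
  define h where "h = Poly (rev ys)"
  let ?h = "map_poly to_ac h"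
  have ch: "poly.coeff ?h i = nth_default 0 (rev (map to_ac ys)) i" for i
    by (simp add: h_def rev_map flip: Poly_map_to_ac)
  have hi: "0 \<le> v (poly.coeff ?h i)" for i
    unfolding ch using ys(2) by (auto simp: nth_default_def rev_nth)
  have "residue.eval ?I (res u) = res (eval_ac h u)"
    using res_eval[OF ys(2) u] ys(1) by (simp add: h_def eval_ac_Poly)
  then have pos: "0 < v (eval_ac h u)"
    using Irr(4) res_eq_zero_iff integral_poly[OF hi u] by (metis eval_ac_def)
  define d where "d = divided_diff ?h u u"
  define s where "s = synthetic_div ?h u"
  define g where "g = synthetic_div s u"
  have si: "0 \<le> v (poly.coeff s i)" for i unfolding s_def by (rule integral_synthetic_div[OF hi u])
  have gi: "0 \<le> v (poly.coeff g i)" for i unfolding g_def by (rule integral_synthetic_div[OF si u])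
  have d: "d = poly s u" by (simp add: d_def s_def divided_diff_def)
  have di: "0 \<le> v d" unfolding d by (rule integral_poly[OF si u])
  have "v d = 0"
  proof (rule ccontr)
    assume "v d \<noteq> 0"
    then have dpos: "0 < v d" using di by simp
    let ?l = "[:- u, 1:]"
    have hs: "?h = ?l * s + [:eval_ac h u:]"
      unfolding s_def eval_ac_def by (simp only: synthetic_div_correct')
    have sg: "s = ?l * g + [:d:]"
      unfolding g_def d by (simp only: synthetic_div_correct')
    have "l * (l * p + c) + e = l * l * p + (l * c + e)" for l p c e :: "'k alg_closure poly"
      by (simp add: algebra_simps)
    from this[of ?l g "[:d:]" "[:eval_ac h u:]"] have "?h = ?l * ?l * g + (?l * [:d:] + [:eval_ac h u:])"
      using hs unfolding sg by (rule trans[rotated])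
    moreover have "?l * [:d:] + [:eval_ac h u:] = [:eval_ac h u - u * d, d:]" by simp
    \<comment> \<open>If the derivative \<open>d\<close> were not a unit, both coefficients of this
      linear remainder would lie in the maximal ideal, so \<open>h\<close> would reduce to a
      multiple of the square of \<open>x - u\<close>.\<close>
    ultimately have split: "?h = ?l * ?l * g + [:eval_ac h u - u * d, d:]" by (simp only:)
    have li: "0 \<le> v (poly.coeff ?l i)" for i using u by (auto simp: coeff_pCons split: nat.splits)
    have lli: "0 \<le> v (poly.coeff (?l * ?l) i)" for i
      unfolding coeff_mult by (intro le_sum integral_mult li)
    have Ih: "?I = reduction ?h"
    proof -
      have "residue.coeff ?I i = residue.coeff (reduction ?h) i" for i
        unfolding reduction_coeff[OF hi] ch
        using res_coeff[of "rev (map to_ac ys)" i] ys by simp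
      then show ?thesis
        using Irr(1) reduction_carrier[of ?h UNIV] hi residue.carrier_polynomial_shell[OF subfieldE(1)[OF k]]
        by (subst residue.coeff_iff_polynomial_cond[of "carrier kbar"])
          (auto simp: residue_field_UNIV simp flip: univ_poly_carrier)
    qed
    have "?I = reduction (?l * ?l) \<otimes>\<^bsub>poly_ring kbar\<^esub> reduction g"
      unfolding Ih
    proof (rule reduction_mult[OF lli gi hi])
      fix i
      have "poly.coeff ?h i - poly.coeff (?l * ?l * g) i = poly.coeff [:eval_ac h u - u * d, d:] i"
        unfolding split by simp
      moreover have "0 < v (eval_ac h u - u * d)" by (intro less_diff pos mult_pos dpos u)
      ultimately show "0 < v (poly.coeff ?h i - poly.coeff (?l * ?l * g) i)"
        using dpos by (auto simp: coeff_pCons zero_extended_def split: nat.splits)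
    qed
    moreover have "reduction (?l * ?l) = reduction ?l \<otimes>\<^bsub>poly_ring kbar\<^esub> reduction ?l"
      by (rule reduction_mult[OF li li lli]) (simp add: zero_extended_def)
    moreover have "reduction ?l = [\<one>\<^bsub>kbar\<^esub>, \<ominus>\<^bsub>kbar\<^esub> res u]"
      using residue.one_not_zero by (simp add: reduction_def res_minus u flip: res_one)
    moreover have lin: "[\<one>\<^bsub>kbar\<^esub>, \<ominus>\<^bsub>kbar\<^esub> res u] \<in> carrier (poly_ring kbar)"
      using ru by (auto simp: polynomial_def simp flip: univ_poly_carrier)
    moreover have "monoid (poly_ring kbar)"
      using residue.univ_poly_is_monoid[OF residue.carrier_is_subring] .
    ultimately have "?I = ([\<one>\<^bsub>kbar\<^esub>, \<ominus>\<^bsub>kbar\<^esub> res u] [^]\<^bsub>poly_ring kbar\<^esub> (2::nat)) \<otimes>\<^bsub>poly_ring kbar\<^esub> reduction g"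
      by (simp add: numeral_2_eq_2 monoid.nat_pow_Suc monoid.nat_pow_0 monoid.l_one)
    moreover have "reduction g \<in> carrier (poly_ring kbar)"
      using reduction_carrier[of g UNIV] gi by (simp add: residue_field_UNIV)
    ultimately have "([\<one>\<^bsub>kbar\<^esub>, \<ominus>\<^bsub>kbar\<^esub> res u] [^]\<^bsub>poly_ring kbar\<^esub> (2::nat)) pdivides\<^bsub>kbar\<^esub> ?I"
      unfolding pdivides_def factor_def by blast
    then have "2 \<le> residue.alg_mult ?I (res u)"
      using residue.alg_multE(2)[OF ru _ ne] residue.carrier_polynomial_shell[OF subfieldE(1)[OF k] Irr(1)]
      by blast
    then show False using mult by simp
  qed
  then show ?thesis using that[of h] hi pos by (simp add: d_def coeff_map_poly)
qed

text \<open>The exponent is the ramification index: it annihilates the quotient of the value groups,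
  and it is a unit because it is prime to the residue characteristic.\<close>

lemma tame_power:
  assumes "tame v a"
  obtains e :: nat where "0 < e" "v (of_nat e) = 0"
    "\<And>f. eval_ac f a \<noteq> 0 \<Longrightarrow> \<exists>c. c \<noteq> 0 \<and> v (eval_ac f a ^ e) = v (to_ac c)"
proof -
  let ?e = "ramification_index v (adjoin a)"
  \<comment> \<open>The product is the positive degree of \<open>a\<close>. Since
    \<open>card\<close> is \<open>0\<close> on infinite sets, \<open>0 < ?e\<close> also yields the
    finiteness of the set of cosets.\<close>
  have "0 < ?e * residue_degree v (adjoin a)"
    using assms degK_pos[of a] by (simp add: tame_def Let_def degK_def)
  then have e: "0 < ?e" by simp
  note sub = value_group_subfield
  have unit: "v (of_nat ?e) = 0"
    using assms e by (intro of_nat_unit) (auto simp: tame_def Let_def)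
  have "\<exists>c. c \<noteq> 0 \<and> v (eval_ac f a ^ ?e) = v (to_ac c)" if nz: "eval_ac f a \<noteq> 0" for f
  proof -
    obtain g where g: "v (eval_ac f a) = Fin g" using FinE[OF nz] .
    then have "g \<in> value_group v (adjoin a)"
      using eval_ac_mem_adjoin[of f a] nz by (auto simp: value_group_def)
    then have mem: "(\<Sum>j<?e. g) \<in> value_group v base_field"
      unfolding ramification_index_def
      by (intro index_multiple_mem sub[OF base_field_subfield] sub[OF adjoin_subfield])
        (use e in \<open>auto simp: ramification_index_def card_gt_0_iff\<close>)
    have "v (eval_ac f a ^ n) = Fin (\<Sum>j<n. g)" for n
      by (induction n) (auto simp: v_mult g zero_extended_def simp del: sum_constant)
    then show ?thesis using mem unfolding value_group_def by auto
  qed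
  then show ?thesis using that[OF e unit] by blast
qed

end

section \<open>Okutsu sequences\<close>

lemma divided_diff_commute: "divided_diff f a b = divided_diff f b a" for f :: "'a::field poly"
proof (cases "a = b")
  case False
  have "(b - a) * divided_diff f a b = (b - a) * divided_diff f b a"
    by (metis divided_diff_eq minus_diff_eq mult_minus_left)
  then show ?thesis using False by simp
qed simp

lemma (in closure_valuation) v_sum_power: "(\<Sum>j<s. v x) = v (x ^ s)"
  by (induction s) (simp_all add: v_mult add.commute)

text \<open>The difference is \<open>b - c\<close> times a second divided difference, which is
  integral.\<close>

lemma (in closure_valuation) divided_diff_close:
  assumes "\<And>i. 0 \<le> v (poly.coeff h i)" "0 \<le> v a" "0 \<le> v b" "0 \<le> v c" "0 < v (b - c)"
  shows "0 < v (divided_diff h a b - divided_diff h a c)"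
proof -
  have s: "0 \<le> v (poly.coeff (synthetic_div h a) i)" for i
    by (rule integral_synthetic_div[OF assms(1,2)])
  have "divided_diff h a b - divided_diff h a c = (b - c) * divided_diff (synthetic_div h a) c b"
    by (simp add: divided_diff_eq) (simp add: divided_diff_def)
  moreover have "0 \<le> v (divided_diff (synthetic_div h a) c b)"
    unfolding divided_diff_def[of "synthetic_div h a"]
    by (rule integral_poly[OF integral_synthetic_div[OF s assms(4)] assms(3)])
  ultimately show ?thesis using pos_mult[OF assms(5)] by simp
qed

section \<open>The inequalities of a complete Okutsu sequence\<close>

locale okutsu = closure_valuation v
  for v :: "'k::field alg_closure \<Rightarrow> 'g::linordered_ab_group_add extended" +
  fixes r :: nat and \<alpha> :: "nat \<Rightarrow> 'k alg_closure" and \<theta> :: "'k alg_closure"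
  assumes okutsu: "complete_okutsu_sequence v r \<alpha> \<theta>"
begin

lemma degK_less: "i < j \<Longrightarrow> j \<le> r + 1 \<Longrightarrow> degK (\<alpha> i) < degK (\<alpha> j)"
proof (induction j)
  case (Suc j)
  have "degK (\<alpha> j) < degK (\<alpha> (Suc j))"
    using okutsu Suc(3) by (simp add: complete_okutsu_sequence_def)
  then show ?case using Suc by (cases "i = j") auto
qed simp

lemma degK_theta: "i \<le> r \<Longrightarrow> degK (\<alpha> i) < degK \<theta>"
  using degK_less[of i "r + 1"] okutsu by (simp add: complete_okutsu_sequence_def)

lemma theta_neq: "i \<le> r \<Longrightarrow> \<theta> \<noteq> \<alpha> i"
  using degK_theta[of i] by auto

text \<open>The first Okutsu inequality in terms of roots, whose degrees over the base field are at
  most that of \<open>f\<close>; \<open>root_less\<close> does the same with the second.\<close>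

lemma root_le:
  assumes "i \<le> r" "f \<noteq> 0" "Polynomial.degree f < degK (\<alpha> (i + 1))" "poly (map_poly to_ac f) \<beta> = 0"
  shows "v (\<theta> - \<beta>) \<le> v (\<theta> - \<alpha> i)"
proof -
  have "degK \<beta> < degK (\<alpha> (i + 1))"
    using degK_le[of f \<beta>] assms by (simp add: eval_ac_def)
  then show ?thesis using okutsu assms(1) unfolding complete_okutsu_sequence_def by blast
qed

lemma root_less:
  assumes "i \<le> r" "f \<noteq> 0" "Polynomial.degree f < degK (\<alpha> i)" "poly (map_poly to_ac f) \<beta> = 0"
  shows "v (\<theta> - \<beta>) < v (\<theta> - \<alpha> i)"
proof -
  have "degK \<beta> < degK (\<alpha> i)"
    using degK_le[of f \<beta>] assms by (simp add: eval_ac_def)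
  then show ?thesis using okutsu assms(1) unfolding complete_okutsu_sequence_def by blast
qed

text \<open>The strict Okutsu inequality at \<open>j\<close>, with \<open>\<alpha> i\<close> as the
  competing element of smaller degree.\<close>

lemma delta_less: "i < j \<Longrightarrow> j \<le> r \<Longrightarrow> v (\<theta> - \<alpha> i) < v (\<theta> - \<alpha> j)"
  using okutsu degK_less[of i j] unfolding complete_okutsu_sequence_def by auto

lemma delta_le: "i \<le> j \<Longrightarrow> j \<le> r \<Longrightarrow> v (\<theta> - \<alpha> i) \<le> v (\<theta> - \<alpha> j)"
  using delta_less[of i j] by (cases "i = j") auto

lemma degree_chain_poly [simp]: "Polynomial.degree (chain_poly \<alpha> i) = degK (\<alpha> i)"
  by (simp add: chain_poly_def degree_min_polyK)

lemma chain_poly_neq_0 [simp]: "chain_poly \<alpha> i \<noteq> 0"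
  using degK_pos[of "\<alpha> i"] degree_chain_poly[of i] by (metis degree_0 less_irrefl)

lemma chain_poly_root [simp]: "eval_ac (chain_poly \<alpha> i) (\<alpha> i) = 0"
  by (simp add: chain_poly_def min_polyK_root)

section \<open>Expansions along the minimal polynomials of the sequence\<close>

abbreviation coeffs_at :: "nat \<Rightarrow> 'k poly \<Rightarrow> nat \<Rightarrow> 'k poly" where
  "coeffs_at i \<equiv> expansion_coeff (chain_poly \<alpha> i)"

lemma degree_coeffs_at: "Polynomial.degree (coeffs_at i f s) < degK (\<alpha> i)"
  using expansion(2)[of "chain_poly \<alpha> i"] by (simp add: degK_pos)

lemma coeffs_at_expansion:
  "f = (\<Sum>s\<le>Polynomial.degree f. coeffs_at i f s * chain_poly \<alpha> i ^ s)"
  by (rule expansion(1)) (simp add: degK_pos)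

lemma map_poly_expansion:
  "map_poly to_ac f = (\<Sum>s\<le>Polynomial.degree f.
     map_poly to_ac (coeffs_at i f s) * map_poly to_ac (chain_poly \<alpha> i) ^ s)"
  by (subst coeffs_at_expansion[of f i]) (simp add: map_poly_to_ac_sum)

lemma chain_poly_root_le:
  "i \<le> r \<Longrightarrow> poly (map_poly to_ac (chain_poly \<alpha> i)) \<beta> = 0 \<Longrightarrow> v (\<theta> - \<beta>) \<le> v (\<theta> - \<alpha> i)"
  using root_le[of i "chain_poly \<alpha> i"] degK_less[of i "i + 1"] by simp

lemma coeffs_at_root_less:
  "i \<le> r \<Longrightarrow> map_poly to_ac (coeffs_at i f s) \<noteq> 0 \<Longrightarrow>
    poly (map_poly to_ac (coeffs_at i f s)) \<beta> = 0 \<Longrightarrow> v (\<theta> - \<beta>) < v (\<theta> - \<alpha> i)"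
  using root_less[of i "coeffs_at i f s"] degree_coeffs_at by simp

text \<open>Orthogonality of the terms of the expansion. Below the next degree no root of
  \<open>f\<close> is closer to \<open>\<theta>\<close> than \<open>\<alpha> i\<close>, as
  \<open>expansion_le_term\<close> requires.\<close>

lemma eval_le_expansion_term:
  assumes "i \<le> r" "Polynomial.degree f < degK (\<alpha> (i + 1))" "s \<le> Polynomial.degree f"
  shows "v (eval_ac f \<theta>) \<le> v (eval_ac (coeffs_at i f s) \<theta> * eval_ac (chain_poly \<alpha> i) \<theta> ^ s)"
  unfolding eval_ac_def
  by (rule expansion_le_term[of \<theta> "\<alpha> i" _ "{..Polynomial.degree f}" "\<lambda>s. map_poly to_ac (coeffs_at i f s)"])
    (use assms theta_neq chain_poly_root[of i, unfolded eval_ac_def] degK_pos chain_poly_root_le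
      coeffs_at_root_less map_poly_expansion root_le in auto)

text \<open>Realises the attached valuation on a given \<open>f\<close> as evaluation at a generic
  point \<open>t\<close>, so that it can be compared with evaluation at \<open>\<theta>\<close>
  factor by factor.\<close>

lemma chain_valuation_generic:
  assumes "i \<le> r" "f \<noteq> 0"
  obtains t where "v (t - \<alpha> i) = v (\<theta> - \<alpha> i)"
    "\<And>\<beta>. poly (map_poly to_ac f) \<beta> = 0 \<Longrightarrow> v (t - \<beta>) \<le> v (\<theta> - \<alpha> i)"
    "chain_valuation v \<theta> \<alpha> i f = v (eval_ac f t)"
proof -
  let ?S = "{..Polynomial.degree f}"
  let ?\<phi> = "map_poly to_ac (chain_poly \<alpha> i)"
  let ?a = "\<lambda>s. map_poly to_ac (coeffs_at i f s)"
  have fin: "finite {\<beta>. poly (map_poly to_ac f) \<beta> = 0}" using assms by (intro poly_roots_finite) simp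
  obtain t where t: "v (t - \<alpha> i) = v (\<theta> - \<alpha> i)"
    "\<And>\<beta>. \<beta> \<in> {\<beta>. poly (map_poly to_ac f) \<beta> = 0} \<Longrightarrow> v (t - \<beta>) \<le> v (\<theta> - \<alpha> i)"
    "\<And>s. s \<in> ?S \<Longrightarrow> v (poly (?a s) t * poly ?\<phi> t ^ s) = v (poly (?a s) \<theta> * poly ?\<phi> \<theta> ^ s)"
    "\<And>s. s \<in> ?S \<Longrightarrow> v (poly (\<Sum>s\<in>?S. ?a s * ?\<phi> ^ s) t) \<le> v (poly (?a s) \<theta> * poly ?\<phi> \<theta> ^ s)"
    by (rule generic_expansion[of \<theta> "\<alpha> i" ?\<phi> ?S ?a "{\<beta>. poly (map_poly to_ac f) \<beta> = 0}"])
      (use assms theta_neq chain_poly_root[of i, unfolded eval_ac_def] degK_pos chain_poly_root_le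
        coeffs_at_root_less fin in auto)
  note f = map_poly_expansion[of f i]
  have cv: "chain_valuation v \<theta> \<alpha> i f = (MIN s\<in>?S. v (poly (?a s) \<theta> * poly ?\<phi> \<theta> ^ s))"
    by (simp add: chain_valuation_def expansion_valuation_def v_sum_power v_mult eval_ac_def)
  have "v (eval_ac f t) = (MIN s\<in>?S. v (poly (?a s) \<theta> * poly ?\<phi> \<theta> ^ s))"
  \<comment> \<open>One inequality is the absence of cancellation at \<open>t\<close>, the other is
    the ultrametric inequality.\<close>
  proof (rule antisym)
    show "v (eval_ac f t) \<le> (MIN s\<in>?S. v (poly (?a s) \<theta> * poly ?\<phi> \<theta> ^ s))"
      using t(4) by (simp add: eval_ac_def flip: f)
    have "eval_ac f t = (\<Sum>s\<in>?S. poly (?a s) t * poly ?\<phi> t ^ s)"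
      unfolding eval_ac_def by (subst f) (simp add: poly_sum)
    then show "(MIN s\<in>?S. v (poly (?a s) \<theta> * poly ?\<phi> \<theta> ^ s)) \<le> v (eval_ac f t)"
      using t(3) by (auto intro!: le_sum)
  qed
  then show ?thesis using that[of t] t cv by simp
qed

text \<open>The expansion of the polynomial in its own powers has the single nonzero coefficient
  \<open>1\<close>, at exponent \<open>1\<close>.\<close>

lemma chain_valuation_self: "chain_valuation v \<theta> \<alpha> i (chain_poly \<alpha> i) = v (eval_ac (chain_poly \<alpha> i) \<theta>)"
proof -
  let ?\<phi> = "chain_poly \<alpha> i"
  have pos: "0 < Polynomial.degree ?\<phi>" by (simp add: degK_pos)
  have c0: "coeffs_at i ?\<phi> 0 = 0" by (simp add: expansion_coeff_def)
  have c1: "coeffs_at i ?\<phi> (Suc 0) = 1"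
    using pos by (simp add: expansion_coeff_def mod_poly_less)
  have c2: "coeffs_at i ?\<phi> s = 0" if "2 \<le> s" for s
  proof -
    have "Polynomial.degree ?\<phi> < s * Polynomial.degree ?\<phi>"
      using pos that mult_le_mono1[of 2 s "Polynomial.degree ?\<phi>"] by linarith
    then have "?\<phi> div ?\<phi> ^ s = 0"
      using chain_poly_neq_0[of i] by (intro div_poly_less) (simp add: degree_power_eq del: degree_chain_poly)
    then show ?thesis by (simp add: expansion_coeff_def)
  qed
  have terms: "v (eval_ac (coeffs_at i ?\<phi> s) \<theta>) + (\<Sum>j<s. v (eval_ac ?\<phi> \<theta>)) =
      (if s = 1 then v (eval_ac ?\<phi> \<theta>) else \<infinity>)" for s
    using c0 c1 c2[of s] v_mult[of 0 "eval_ac ?\<phi> \<theta> ^ s"]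
    by (cases "s = 0"; cases "s = 1") (simp_all add: v_sum_power)
  show ?thesis
    unfolding chain_valuation_def expansion_valuation_def terms
  proof (rule Min_eqI)
    show "v (eval_ac ?\<phi> \<theta>) \<in> (\<lambda>s. if s = 1 then v (eval_ac ?\<phi> \<theta>) else \<infinity>) ` {..Polynomial.degree ?\<phi>}"
      using pos by (intro image_eqI[of _ _ 1]) auto
  qed auto
qed

section \<open>Divided differences on tame extensions and separation of conjugates\<close>

lemma eval_close:
  assumes "i < r" "Polynomial.degree f < degK (\<alpha> (i + 1))" "f \<noteq> 0"
    and "v (\<theta> - \<alpha> i) < v (\<theta> - x)" "v (\<theta> - \<alpha> i) < v (x - y)"
  shows "v (eval_ac f x) < v (eval_ac f x - eval_ac f y)"
  unfolding eval_ac_def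
proof (rule poly_close)
  fix \<beta> assume "poly (map_poly to_ac f) \<beta> = 0"
  \<comment> \<open>Every root is at least as far from \<open>\<theta>\<close> as
    \<open>\<alpha> i\<close>, while \<open>x\<close> is nearer; so the root is as far from
    \<open>x\<close> as from \<open>\<theta>\<close>, hence farther from \<open>x\<close> than
    \<open>y\<close> is.\<close>
  then have le: "v (\<theta> - \<beta>) \<le> v (\<theta> - \<alpha> i)" using assms root_le by simp
  then have "v (\<theta> - \<beta>) < v (\<theta> - x)" using assms(4) by simp
  then have "v (x - \<beta>) = v (\<theta> - \<beta>)" using eq_of_diff_less[of "\<theta> - \<beta>" "x - \<beta>"] by simp
  then show "v (x - \<beta>) < v (x - y)" using le assms(5) by simp
qed (use assms in simp)

lemma eval_eq_theta:
  assumes "i < j" "j \<le> r" "Polynomial.degree f < degK (\<alpha> (i + 1))"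
  shows "v (eval_ac f (\<alpha> j)) = v (eval_ac f \<theta>)"
proof (cases "f = 0")
  case False
  have "v (eval_ac f (\<alpha> j)) < v (eval_ac f (\<alpha> j) - eval_ac f \<theta>)"
    using assms False delta_less[OF assms(1,2)]
    by (intro eval_close[of i]) (auto simp: v_diff_commute[of "\<alpha> j"])
  then show ?thesis using eq_of_diff_less by metis
qed simp

text \<open>The quotient \<open>D b / b(\<alpha> i)\<close> of least value bounds \<open>D\<close>
  from below on all polynomials of small degree. Induction on \<open>j\<close> reduces this to
  finitely many coefficient spaces of the expansion, which are orthogonal.\<close>

lemma min_ratio:
  fixes D :: "'k poly \<Rightarrow> 'k alg_closure"
  assumes "\<And>p q. D (p + q) = D p + D q" "\<And>c p. D (smult c p) = to_ac c * D p"
    and "j \<le> i" "i \<le> r"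
  shows "\<exists>b. eval_ac b (\<alpha> i) \<noteq> 0 \<and> (\<forall>a. Polynomial.degree a < degK (\<alpha> j) \<longrightarrow>
    v (D b / eval_ac b (\<alpha> i) * eval_ac a (\<alpha> i)) \<le> v (D a))"
  using assms(1-3)
proof (induction j arbitrary: D)
  case 0
  have "v (D 1 * eval_ac a (\<alpha> i)) \<le> v (D a)" if a: "Polynomial.degree a < degK (\<alpha> 0)" for a
  proof -
    have "Polynomial.degree a = 0" using a okutsu by (simp add: complete_okutsu_sequence_def)
    then obtain c where "a = smult c 1" by (metis degree_0_id smult_one)
    then show ?thesis using 0(2)[of c 1] by (simp add: mult.commute)
  qed
  then show ?case by (intro exI[of _ 1]) simp
next
  case (Suc j)
  let ?x = "\<alpha> i" and ?\<phi> = "chain_poly \<alpha> j"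
  have j: "j < i" "j \<le> r" "j + 1 \<le> i" using Suc(4) assms(4) by auto
  have D_sum: "D (sum f I) = (\<Sum>i\<in>I. D (f i))" if "finite I" for f and I :: "nat set"
    using that
  proof (induction I rule: finite_induct)
    case empty
    show ?case using Suc(3)[of 0 0] by simp
  qed (simp add: Suc(2))
  have \<phi>x: "eval_ac ?\<phi> ?x \<noteq> 0"
    using eval_ac_nonzero[of ?\<phi> ?x] degK_less[of j i] j assms(4) by simp
  \<comment> \<open>The induction hypothesis is applied for each exponent \<open>s\<close> to the
    linear map that sends \<open>a\<close> to \<open>D (a * ?\<phi> ^ s)\<close>, which is why
    \<open>D\<close> is kept arbitrary.\<close>
  have "\<forall>s. \<exists>b. eval_ac b ?x \<noteq> 0 \<and> (\<forall>a. Polynomial.degree a < degK (\<alpha> j) \<longrightarrow>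
      v (D (b * ?\<phi> ^ s) / eval_ac b ?x * eval_ac a ?x) \<le> v (D (a * ?\<phi> ^ s)))"
    using Suc(1)[of "\<lambda>a. D (a * ?\<phi> ^ s)" for s] Suc(2,3) j by (simp add: distrib_right)
  then obtain b where b: "\<And>s. eval_ac (b s) ?x \<noteq> 0"
    "\<And>s a. Polynomial.degree a < degK (\<alpha> j) \<Longrightarrow>
      v (D (b s * ?\<phi> ^ s) / eval_ac (b s) ?x * eval_ac a ?x) \<le> v (D (a * ?\<phi> ^ s))"
    by metis
  define B where "B s = b s * ?\<phi> ^ s" for s
  have B: "eval_ac (B s) ?x \<noteq> 0" for s using b(1) \<phi>x by (simp add: B_def)
  define \<rho> where "\<rho> s = D (B s) / eval_ac (B s) ?x" for s
  \<comment> \<open>Exponents in the expansion of \<open>a\<close> are bounded by its degree, so a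
    minimum over this finite set is enough.\<close>
  let ?N = "{..<degK (\<alpha> (Suc j))}"
  have "finite (v ` \<rho> ` ?N)" "v ` \<rho> ` ?N \<noteq> {}" using degK_pos by auto
  then have "Min (v ` \<rho> ` ?N) \<in> v ` \<rho> ` ?N" by (rule Min_in)
  then obtain s0 where s0: "Min (v ` \<rho> ` ?N) = v (\<rho> s0)" by auto
  have min: "v (\<rho> s0) \<le> v (\<rho> s)" if "s \<in> ?N" for s
    unfolding s0[symmetric] using that by (intro Min_le) auto
  have "v (\<rho> s0 * eval_ac a ?x) \<le> v (D a)" if a: "Polynomial.degree a < degK (\<alpha> (Suc j))" for a
  proof -
    have "v (\<rho> s0 * eval_ac a ?x) \<le> v (D (coeffs_at j a s * ?\<phi> ^ s))" if s: "s \<le> Polynomial.degree a" for s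
    proof -
      let ?c = "coeffs_at j a s"
      have lt: "degK (\<alpha> j) < degK (\<alpha> (j + 1))" using degK_less[of j "j + 1"] j by simp
      have tr: "v (eval_ac p ?x) = v (eval_ac p \<theta>)" if "Polynomial.degree p < degK (\<alpha> (j + 1))" for p
        using eval_eq_theta[OF j(1) assms(4) that] .
      \<comment> \<open>Orthogonality is known at \<open>\<theta>\<close>; the transfer
        \<open>tr\<close> moves it to \<open>?x\<close>.\<close>
      have "v (eval_ac a \<theta>) \<le> v (eval_ac ?c \<theta> * eval_ac ?\<phi> \<theta> ^ s)"
        using eval_le_expansion_term[OF j(2)] a s by simp
      also have "\<dots> = v (eval_ac ?c ?x * eval_ac ?\<phi> ?x ^ s)"
        using tr[of ?c] tr[of ?\<phi>] degree_coeffs_at[of j a s] lt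
        by (intro v_mult_eq v_power_eq) auto
      finally have "v (eval_ac a ?x) \<le> v (eval_ac ?c ?x * eval_ac ?\<phi> ?x ^ s)"
        using tr[of a] a by simp
      moreover have "v (\<rho> s0) \<le> v (\<rho> s)" using min s a by simp
      ultimately have "v (\<rho> s0 * eval_ac a ?x) \<le> v (\<rho> s * (eval_ac ?c ?x * eval_ac ?\<phi> ?x ^ s))"
        by (intro mult_mono)
      also have "\<rho> s * (eval_ac ?c ?x * eval_ac ?\<phi> ?x ^ s) =
          D (b s * ?\<phi> ^ s) / eval_ac (b s) ?x * eval_ac ?c ?x"
        using \<phi>x b(1)[of s] by (simp add: \<rho>_def B_def)
      also have "v \<dots> \<le> v (D (?c * ?\<phi> ^ s))" using b(2) degree_coeffs_at by blast
      finally show ?thesis .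
    qed
    then have "v (\<rho> s0 * eval_ac a ?x) \<le> v (\<Sum>s\<le>Polynomial.degree a. D (coeffs_at j a s * ?\<phi> ^ s))"
      by (intro le_sum) auto
    also have "(\<Sum>s\<le>Polynomial.degree a. D (coeffs_at j a s * ?\<phi> ^ s)) = D a"
      using D_sum[of "{..Polynomial.degree a}" "\<lambda>s. coeffs_at j a s * ?\<phi> ^ s"]
        coeffs_at_expansion[of a j] by simp
    finally show ?thesis .
  qed
  then show ?case using B unfolding \<rho>_def by blast
qed

text \<open>Tameness enters here, to keep the remaining conjugates of \<open>\<alpha> i\<close> from
  being closer to it than the preceding distance. The root \<open>y\<close> of \<open>q\<close>
  makes \<open>D\<close> vanish on \<open>?\<phi>\<close>, so \<open>D\<close> lives on residue
  classes modulo \<open>?\<phi>\<close>.\<close>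

lemma tame_separation:
  assumes tame: "tame v (\<alpha> r)" and i: "0 < i" "i \<le> r"
    and q: "map_poly to_ac (chain_poly \<alpha> i) = [:- \<alpha> i, 1:] * q" "poly q y = 0"
  shows "v (\<alpha> i - y) \<le> v (\<theta> - \<alpha> (i - 1))"
proof (rule ccontr)
  let ?x = "\<alpha> i" and ?\<phi> = "chain_poly \<alpha> i"
  define j where "j = i - 1"
  have j: "i = Suc j" "j < r" using i by (auto simp: j_def)
  assume "\<not> ?thesis"
  then have xy: "v (\<theta> - \<alpha> j) < v (?x - y)" by (simp add: j_def)
  have dij: "v (\<theta> - \<alpha> j) < v (\<theta> - ?x)" using delta_less[of j i] j i by simp
  define D where "D f = divided_diff (map_poly to_ac f) ?x y" for f
  have \<phi>y: "eval_ac ?\<phi> y = 0" using q by (simp add: eval_ac_def)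
  have D\<phi>: "D ?\<phi> = 0"
    unfolding D_def using divided_diff_unique[of "map_poly to_ac ?\<phi>" ?x q 0 y] q by simp
  have D_add: "D (p + p') = D p + D p'" for p p'
    by (simp add: D_def divided_diff_add)
  have D_smult: "D (smult c p) = to_ac c * D p" for c p
    by (simp add: D_def divided_diff_smult)
  have D_mult: "D (p * p') = D p * eval_ac p' y + eval_ac p ?x * D p'" for p p'
    by (simp add: D_def divided_diff_mult eval_ac_def)
  have red: "D (f mod ?\<phi>) = D f" "eval_ac (f mod ?\<phi>) ?x = eval_ac f ?x"
      "eval_ac (f mod ?\<phi>) y = eval_ac f y" "Polynomial.degree (f mod ?\<phi>) < degK ?x" for f
  proof -
    have *: "f = ?\<phi> * (f div ?\<phi>) + f mod ?\<phi>" by simp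
    have "D f = D (?\<phi> * (f div ?\<phi>)) + D (f mod ?\<phi>)"
      using D_add[of "?\<phi> * (f div ?\<phi>)" "f mod ?\<phi>"] by simp
    then show "D (f mod ?\<phi>) = D f" by (simp add: D_mult D\<phi>)
    have ev: "eval_ac f z = eval_ac ?\<phi> z * eval_ac (f div ?\<phi>) z + eval_ac (f mod ?\<phi>) z" for z
      by (subst *) (simp only: eval_ac_simps)
    show "eval_ac (f mod ?\<phi>) ?x = eval_ac f ?x" "eval_ac (f mod ?\<phi>) y = eval_ac f y"
      using ev[of ?x] ev[of y] \<phi>y by simp_all
    show "Polynomial.degree (f mod ?\<phi>) < degK ?x"
      using degree_mod_less[OF chain_poly_neq_0[of i], of f] degK_pos[of ?x] by auto
  qed
  have near_y: "v (eval_ac f ?x) < v (eval_ac f ?x - eval_ac f y)" if "eval_ac f ?x \<noteq> 0" for f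
  proof -
    have "f mod ?\<phi> \<noteq> 0" using that red(2)[of f] by auto
    then have "v (eval_ac (f mod ?\<phi>) ?x) < v (eval_ac (f mod ?\<phi>) ?x - eval_ac (f mod ?\<phi>) y)"
      using red(4)[of f] j xy dij by (intro eval_close[of j]) auto
    then show ?thesis by (simp add: red)
  qed
  \<comment> \<open>Tameness is assumed for \<open>\<alpha> r\<close>. This comparison carries
    values and residues from \<open>\<alpha> i\<close> to \<open>\<alpha> r\<close>.\<close>
  have near_r: "v (eval_ac f ?x) < v (eval_ac f ?x - eval_ac f (\<alpha> r))"
    if "eval_ac f ?x \<noteq> 0" "Polynomial.degree f < degK ?x" for f
  proof (rule eval_close[of j])
    show "v (\<theta> - \<alpha> j) < v (?x - \<alpha> r)"
      using dij delta_le[of i r] i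
      by (intro less_diff[of _ "\<theta> - \<alpha> r" "\<theta> - ?x", simplified]) auto
  qed (use that j dij in auto)
  \<comment> \<open>With both indices equal to \<open>i\<close>, the degree bound admits a
    representative of every class modulo \<open>?\<phi>\<close>.\<close>
  obtain b where b: "eval_ac b ?x \<noteq> 0" "\<And>a. Polynomial.degree a < degK ?x \<Longrightarrow>
      v (D b / eval_ac b ?x * eval_ac a ?x) \<le> v (D a)"
    using min_ratio[of D i i] D_add D_smult i by blast
  define \<rho> where "\<rho> = D b / eval_ac b ?x"
  have ratio: "v (\<rho> * eval_ac f ?x) \<le> v (D f)" for f
    using b(2)[OF red(4)[of f]] by (simp add: red \<rho>_def)
  \<comment> \<open>\<open>D\<close> is not zero, so the minimal ratio \<open>\<rho>\<close> is not
    zero either.\<close>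
  have "D [:0, 1:] = 1" by (simp add: D_def)
  then have \<rho>: "\<rho> \<noteq> 0" using ratio[of "[:0, 1:]"] by (auto simp: zero_extended_def)
  have step_pos: "v \<rho> < v (D f)" if "0 < v (eval_ac f ?x)" for f
    using ratio[of f] mult_less_cancel[OF \<rho>, of 1 "eval_ac f ?x"] that by simp
  have step_unit: "v \<rho> < v (D f)" if unit: "v (eval_ac f ?x) = 0" for f
  proof -
    let ?g = "f mod ?\<phi>"
    define w w' u where "w = eval_ac ?g ?x" "w' = eval_ac ?g y" "u = eval_ac ?g (\<alpha> r)"
    have w: "v w = 0" using unit red(2)[of f] by (simp add: w_w'_u_def)
    then have w0: "w \<noteq> 0" by (auto simp: zero_extended_def)
    have wu: "0 < v (w - u)" using near_r[of ?g] red(4)[of f] w w0 by (simp add: w_w'_u_def)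
    have ww': "0 < v (w - w')" using near_y[of ?g] w w0 by (simp add: w_w'_u_def)
    have u: "v u = 0" using eq_of_diff_less[of w u] w wu by simp
    have w': "v w' = 0" using eq_of_diff_less[of w w'] w ww' by simp
    have uw: "0 < v (u - w)" using wu v_diff_commute by metis
    have uw': "0 < v (u - w')" using less_add[OF uw ww'] by simp
    have sep: "residue_separable v (adjoin (\<alpha> r))" using tame by (simp add: tame_def Let_def)
    \<comment> \<open>\<open>w\<close>, \<open>w'\<close> and \<open>u\<close> share one residue,
      and \<open>h\<close> has a simple root there.\<close>
    obtain h where h: "\<And>n. 0 \<le> v (to_ac (poly.coeff h n))" "0 < v (eval_ac h u)"
        "v (divided_diff (map_poly to_ac h) u u) = 0"
      using residue_separable_lift[OF sep, of u] eval_ac_mem_adjoin u by (auto simp: w_w'_u_def)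
    let ?h = "map_poly to_ac h"
    have hi: "0 \<le> v (poly.coeff ?h n)" for n using h(1) by (simp add: coeff_map_poly)
    note close = divided_diff_close[OF hi]
    \<comment> \<open>The unit \<open>h[u, u]\<close> is carried to \<open>h[w, w']\<close> by
      moving one argument at a time.\<close>
    have 1: "v (divided_diff ?h u w') = 0"
      using eq_of_diff_less[of "divided_diff ?h u u" "divided_diff ?h u w'"] close[of u u w'] u w' uw' h(3)
      by simp
    have 2: "v (divided_diff ?h w' w) = 0"
      using eq_of_diff_less[of "divided_diff ?h w' u" "divided_diff ?h w' w"] close[of w' u w] u w w' uw 1
      by (simp add: divided_diff_commute[of _ w' u])
    have "0 < v ((w - u) * divided_diff ?h u w)"
    proof (rule pos_mult[OF wu])
      show "0 \<le> v (divided_diff ?h u w)"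
        unfolding divided_diff_def using u w by (intro integral_poly integral_synthetic_div hi) auto
    qed
    then have "0 < v (poly ?h w - poly ?h u)" by (simp add: divided_diff_eq)
    then have "0 < v ((poly ?h w - poly ?h u) + poly ?h u)"
      using h(2) by (intro less_add) (simp_all add: eval_ac_def)
    moreover have "eval_ac (h \<circ>\<^sub>p ?g) ?x = poly ?h w"
      by (simp add: eval_ac_def map_poly_to_ac_pcompose poly_pcompose w_w'_u_def)
    \<comment> \<open>The composite has positive value at \<open>?x\<close>, so
      \<open>step_pos\<close> applies; by the chain rule its divided difference is
      \<open>D ?g\<close> times a unit.\<close>
    ultimately have "v \<rho> < v (D (h \<circ>\<^sub>p ?g))" by (intro step_pos) simp
    also have "D (h \<circ>\<^sub>p ?g) = divided_diff ?h w w' * D ?g"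
      by (simp add: D_def map_poly_to_ac_pcompose divided_diff_pcompose w_w'_u_def eval_ac_def)
    also have "v \<dots> = v (D f)" using 2 by (simp add: v_mult divided_diff_commute[of _ w w'] red)
    finally show ?thesis .
  qed
  obtain e :: nat where e: "0 < e" "v (of_nat e) = 0"
    "\<And>f. eval_ac f (\<alpha> r) \<noteq> 0 \<Longrightarrow> \<exists>c. c \<noteq> 0 \<and> v (eval_ac f (\<alpha> r) ^ e) = v (to_ac c)"
    using tame_power[OF tame] by metis
  have step: "v (\<rho> * eval_ac f ?x) < v (D f)" if fx: "eval_ac f ?x \<noteq> 0" for f
  proof -
    let ?g = "f mod ?\<phi>"
    define w w' u where "w = eval_ac ?g ?x" "w' = eval_ac ?g y" "u = eval_ac ?g (\<alpha> r)"
    have w: "w \<noteq> 0" using fx red(2)[of f] by (simp add: w_w'_u_def)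
    have "v u = v w" using eq_of_diff_less[OF near_r[of ?g]] red(4)[of f] w by (simp add: w_w'_u_def)
    moreover from this w have "u \<noteq> 0" by (metis eq_Pinf_iff)
    ultimately obtain c where c: "c \<noteq> 0" "v (w ^ e) = v (to_ac c)"
      using e(3)[of ?g] v_power_eq[of u w e] by (auto simp: w_w'_u_def)
    have ww': "v w < v (w - w')" using near_y[of ?g] w by (simp add: w_w'_u_def)
    define z where "z = w' / w"
    have z: "0 < v (z - 1)"
    proof -
      have "v (w * 1) < v (w * (z - 1))"
        using ww' w v_diff_commute[of w w'] by (simp add: z_def algebra_simps)
      then show ?thesis using mult_less_cancel[OF w, of 1 "z - 1"] by simp
    qed
    have zi: "0 \<le> v z" using le_add[of 0 "z - 1" 1] z by simp
    have zn: "0 < v (z ^ n - 1)" for n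
    proof (induction n)
      case (Suc n)
      have "z ^ Suc n - 1 = z * (z ^ n - 1) + (z - 1)" by (simp add: algebra_simps)
      then show ?case using less_add[OF mult_pos[OF Suc zi] z] by (simp only:)
    qed (simp add: zero_extended_def)
    \<comment> \<open>As \<open>z\<close> is congruent to \<open>1\<close>, this sum is congruent to
      \<open>e\<close>, a unit by tameness.\<close>
    define S where "S = (\<Sum>n<e. z ^ (e - Suc n))"
    have "0 < v (\<Sum>n<e. z ^ (e - Suc n) - 1)"
      by (rule less_sum[OF _ zn]) (simp add: zero_extended_def)
    then have "0 < v (of_nat e - S)"
      using v_diff_commute[of S "of_nat e"] by (simp add: S_def sum_subtractf)
    then have S: "v S = 0" using eq_of_diff_less[of "of_nat e" S] e(2) by simp
    have wz: "w' = w * z" using w by (simp add: z_def)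
    have sum_eq: "(\<Sum>n<e. w ^ n * w' ^ (e - Suc n)) = w ^ (e - 1) * S"
    proof -
      have "w ^ n * w' ^ (e - Suc n) = w ^ (e - 1) * z ^ (e - Suc n)" if "n < e" for n
      proof -
        have "w ^ (e - 1) = w ^ n * w ^ (e - Suc n)" using that by (simp flip: power_add)
        then show ?thesis by (simp add: wz power_mult_distrib)
      qed
      then show ?thesis by (simp add: S_def sum_distrib_left)
    qed
    \<comment> \<open>Dividing the power by \<open>c\<close> gives a unit at \<open>?x\<close>, to
      which \<open>step_unit\<close> applies; the power rule then brings the bound back to
      \<open>?g\<close>.\<close>
    define F where "F = smult (inverse c) (?g ^ e)"
    have "to_ac c * eval_ac F ?x = w ^ e"
      using c(1) by (simp add: F_def w_w'_u_def flip: mult.assoc)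
    then have "v (to_ac c * eval_ac F ?x) = v (to_ac c)" using c(2) by simp
    moreover obtain g where "v (to_ac c) = Fin g" using c(1) FinE[of "to_ac c"] by auto
    ultimately have "v (eval_ac F ?x) = 0"
      by (cases "v (eval_ac F ?x)") (simp_all add: v_mult zero_extended_def)
    then have "v \<rho> < v (D F)" by (rule step_unit)
    then have "v (to_ac c * \<rho>) < v (to_ac c * D F)" using mult_less_cancel c(1) by simp
    also have "to_ac c * D F = D ?g * (w ^ (e - 1) * S)"
    proof -
      have "D (?g ^ e) = D ?g * (\<Sum>n<e. w ^ n * w' ^ (e - Suc n))"
        by (simp add: D_def divided_diff_power w_w'_u_def eval_ac_def)
      then show ?thesis using c(1) unfolding F_def D_smult sum_eq by (simp flip: mult.assoc)
    qed
    also have "v \<dots> = v (w ^ (e - 1) * D ?g)" by (simp add: v_mult S ac_simps)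
    also have "v (to_ac c * \<rho>) = v (w ^ e * \<rho>)" using c(2) by (simp add: v_mult)
    also have "w ^ e * \<rho> = w ^ (e - 1) * (\<rho> * w)" using e(1) by (simp add: power_eq_if)
    finally have "v (\<rho> * w) < v (D ?g)" using mult_less_cancel[of "w ^ (e - 1)"] w by simp
    then show ?thesis by (simp add: red w_w'_u_def)
  qed
  \<comment> \<open>For \<open>b\<close> itself \<open>\<rho> * b(\<alpha> i)\<close> equals
    \<open>D b\<close>, so the strict inequality fails.\<close>
  show False using step[OF b(1)] b(1) by (simp add: \<rho>_def)
qed

lemma slope_difference:
  assumes tame: "tame v (\<alpha> r)" and i: "Suc i \<le> r"
  shows "secondary_slope v \<theta> \<alpha> (Suc i) = v (\<theta> - \<alpha> (Suc i)) - v (\<theta> - \<alpha> i)"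
proof -
  let ?x = "\<alpha> (Suc i)" and ?\<phi> = "chain_poly \<alpha> (Suc i)" and ?\<delta> = "v (\<theta> - \<alpha> i)"
  have less: "?\<delta> < v (\<theta> - ?x)" using delta_less[of i "Suc i"] i by simp
  obtain t where t: "v (t - \<alpha> i) = ?\<delta>"
    "\<And>\<beta>. poly (map_poly to_ac ?\<phi>) \<beta> = 0 \<Longrightarrow> v (t - \<beta>) \<le> ?\<delta>"
    "chain_valuation v \<theta> \<alpha> i ?\<phi> = v (eval_ac ?\<phi> t)"
    using chain_valuation_generic[of i ?\<phi>] i by auto
  have top: "chain_valuation v \<theta> \<alpha> (Suc i) ?\<phi> = v (eval_ac ?\<phi> \<theta>)"
    by (rule chain_valuation_self)
  have root: "poly (map_poly to_ac ?\<phi>) ?x = 0" using chain_poly_root[of "Suc i"] by (simp add: eval_ac_def)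
  then obtain q where q: "map_poly to_ac ?\<phi> = [:- ?x, 1:] * q" by (metis dvdE poly_eq_0_iff_dvd)
  have t\<theta>: "?\<delta> \<le> v (\<theta> - t)" using le_diff[of ?\<delta> "\<theta> - \<alpha> i" "t - \<alpha> i"] t(1) by simp
  have "v (t - ?x) = ?\<delta>"
  proof (rule antisym[OF t(2)[OF root]])
    show "?\<delta> \<le> v (t - ?x)"
      using le_diff[of ?\<delta> "\<theta> - ?x" "\<theta> - t"] t\<theta> less by simp
  qed
  \<comment> \<open>Separation places every root of \<open>q\<close> equally far from
    \<open>\<theta>\<close> and from \<open>t\<close>, so this factor cancels in the slope and only
    the factor of \<open>\<alpha> (Suc i)\<close> remains.\<close>
  moreover have q_eq: "v (poly q t) = v (poly q \<theta>)"
  proof (rule poly_cong)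
    fix \<beta> assume \<beta>: "poly q \<beta> = 0"
    have le: "v (?x - \<beta>) \<le> ?\<delta>" using tame_separation[OF tame _ i q \<beta>] by simp
    then have "v (\<theta> - \<beta>) = v (?x - \<beta>)"
      using add_eq_left[of "?x - \<beta>" "\<theta> - ?x"] less by simp
    then show "v (t - \<beta>) = v (\<theta> - \<beta>)"
      using eq_of_le_of_diff[of "\<theta> - \<beta>" ?\<delta> "t - \<beta>"] le t(2)[of \<beta>] t\<theta> \<beta> by (simp add: q)
  qed
  moreover have ev: "eval_ac ?\<phi> z = (z - ?x) * poly q z" for z
    by (simp add: eval_ac_def q algebra_simps)
  moreover have "poly q \<theta> \<noteq> 0"
    using eval_ac_nonzero[of ?\<phi> \<theta>] degK_theta[OF i] ev[of \<theta>] by auto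
  then obtain c where "v (poly q \<theta>) = Fin c" by (rule FinE)
  \<comment> \<open>Cancelling in a difference of extended values requires finite ones.\<close>
  moreover obtain d d' where "v (\<theta> - ?x) = Fin d" "?\<delta> = Fin d'"
    using FinE[of "\<theta> - ?x"] FinE[of "\<theta> - \<alpha> i"] theta_neq i by (metis Suc_leD right_minus_eq)
  ultimately show ?thesis
    by (simp add: secondary_slope_def top t(3) v_mult)
qed

text \<open>The slope differences telescope. They start from the linear polynomial of
  \<open>\<alpha> 0\<close>, whose value at \<open>\<theta>\<close> is that of
  \<open>\<theta> - \<alpha> 0\<close>.\<close>

lemma delta_eq_sum_slopes:
  assumes "tame v (\<alpha> r)" "i \<le> r"
  shows "v (\<theta> - \<alpha> i) = (\<Sum>j\<le>i. secondary_slope v \<theta> \<alpha> j)"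
  using assms(2)
proof (induction i)
  case 0
  have "Polynomial.degree (chain_poly \<alpha> 0) = 1" using okutsu by (simp add: complete_okutsu_sequence_def)
  moreover have "Polynomial.lead_coeff (chain_poly \<alpha> 0) = 1"
    unfolding chain_poly_def by (rule min_polyK_monic)
  ultimately have "chain_poly \<alpha> 0 = [:poly.coeff (chain_poly \<alpha> 0) 0, 1:]"
    by (intro poly_eqI) (auto simp: coeff_pCons coeff_eq_0 split: nat.splits)
  then obtain a where "chain_poly \<alpha> 0 = [:a, 1:]" by blast
  then have "eval_ac (chain_poly \<alpha> 0) \<theta> = \<theta> - \<alpha> 0"
    using chain_poly_root[of 0] by (simp add: eval_ac_def add_eq_0_iff)
  then show ?case by (simp add: secondary_slope_def chain_valuation_self)
next
  case (Suc i)
  obtain d d' where "v (\<theta> - \<alpha> i) = Fin d" "v (\<theta> - \<alpha> (Suc i)) = Fin d'"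
    using FinE[of "\<theta> - \<alpha> i"] FinE[of "\<theta> - \<alpha> (Suc i)"] theta_neq Suc(2) by (metis Suc_leD right_minus_eq)
  then show ?case using Suc slope_difference[OF assms(1) Suc(2)] by simp
qed

end

theorem proposition3p5:
  fixes vK :: "'k::field \<Rightarrow> 'g::linordered_ab_group_add extended"
    and v :: "'k alg_closure \<Rightarrow> 'g extended"
    and r :: nat
    and \<alpha> :: "nat \<Rightarrow> 'k alg_closure"
    and \<theta> :: "'k alg_closure"
  assumes "henselian_valued_field vK v"
    and "complete_okutsu_sequence v r \<alpha> \<theta>"
    and "tame v (\<alpha> r)"
  shows "\<forall>i\<le>r. v (\<theta> - \<alpha> i) = (\<Sum>j\<le>i. secondary_slope v \<theta> \<alpha> j)"
proof -
  have "valuation v"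
    using assms(1) by (simp add: henselian_valued_field_def extends_to_closure_def)
  then interpret okutsu v r \<alpha> \<theta>
    using assms(2) by unfold_locales
  show ?thesis using delta_eq_sum_slopes[OF assms(3)] by blast
qed

end
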